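(* Let $\mathscr{H}_1,\mathscr{H}_2$ be Hilbert spaces, let $X\in\mathbb{B}(\mathscr{H}_2,\mathscr{H}_1)$ and $Y\in\mathbb{B}(\mathscr{H}_1,\mathscr{H}_2)$, and let $T=\begin{bmatrix}0&X\\ Y&0\end{bmatrix}\in\mathbb{B}(\mathscr{H}_1\oplus\mathscr{H}_2)$. Let $f,g$ be nonnegative continuous functions on $[0,\infty)$ satisfying $f(t)g(t)=t$ for all $t\in[0,\infty)$. Then for every $r\ge 1$, $$\omega^{r}(T)\leq 2^{r-2}\left(\left\|f^{2r}(|X|)+g^{2r}(|Y^*|)\right\|+\left\|f^{2r}(|Y|)+g^{2r}(|X^*|)\right\|\right)-2^{r-2}\inf_{\|(x_1,x_2)\|=1}\zeta(x_1,x_2),$$ where the infimum is over unit vectors $(x_1,x_2)\in\mathscr{H}_1\oplus\mathscr{H}_2$ and $$\zeta(x_1,x_2)=\left(\left\langle\left(f^{2r}(|X|)+g^{2r}(|Y^*|)\right)x_2,x_2\right\rangle^{\frac12}-\left\langle\left(f^{2r}(|Y|)+g^{2r}(|X^*|)\right)x_1,x_1\right\rangle^{\frac12}\right)^2.$$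
   Context: Hilbert spaces are complex. $\mathbb{B}(\mathscr{K},\mathscr{L})$ is the space of bounded linear operators from $\mathscr{K}$ to $\mathscr{L}$, and $\mathbb{B}(\mathscr{K})=\mathbb{B}(\mathscr{K},\mathscr{K})$. The numerical radius of $T\in\mathbb{B}(\mathscr{K})$ is $\omega(T)=\sup\{|\langle Tx,x\rangle| : x\in\mathscr{K},\ \|x\|=1\}$, and $\omega^{r}(T)=(\omega(T))^r$. $|A|=(A^*A)^{1/2}$. $f^{2r}(A)$ denotes $h(A)$, with $h(t)=f(t)^{2r}$, in the continuous functional calculus of the positive operator $A$ (similarly $g^{2r}$). $\|\cdot\|$ is the operator norm on operators; on the direct sum, $\|(x_1,x_2)\|^2=\|x_1\|^2+\|x_2\|^2$. Operators on the direct sum are written as $2\times2$ operator matrices, so $T(x_1,x_2)=(Xx_2,Yx_1)$. *)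

theory Defs
  imports "HOL-Analysis.Analysis" "HOL-Computational_Algebra.Polynomial"
begin

text \<open>Complex inner product spaces, with \<open>cinner\<close> linear in the first argument. The real part of
  \<open>cinner\<close> is the library's real inner product, which makes \<open>cinner\<close> positive definite and
  \<open>norm\<close>, \<open>dist\<close> and the topology the induced ones.\<close>

class complex_inner = real_inner +
  fixes scaleC :: "complex \<Rightarrow> 'a \<Rightarrow> 'a"  (infixr \<open>*\<^sub>C\<close> 75)
    and cinner :: "'a \<Rightarrow> 'a \<Rightarrow> complex"
  assumes scaleC_add_right: "c *\<^sub>C (x + y) = c *\<^sub>C x + c *\<^sub>C y"
    and scaleC_add_left: "(c + d) *\<^sub>C x = c *\<^sub>C x + d *\<^sub>C x"
    and scaleC_scaleC: "c *\<^sub>C (d *\<^sub>C x) = (c * d) *\<^sub>C x"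
    and scaleC_of_real: "complex_of_real s *\<^sub>C x = s *\<^sub>R x"
    and cinner_commute: "cinner x y = cnj (cinner y x)"
    and cinner_add_left: "cinner (x + y) z = cinner x z + cinner y z"
    and cinner_scaleC_left: "cinner (c *\<^sub>C x) y = c * cinner x y"
    and inner_eq_Re_cinner: "inner x y = Re (cinner x y)"

class chilbert_space = complex_inner + complete_space

text \<open>The Hilbert direct sum is the product type; the library's product norm is already
  \<^term>\<open>norm (x, y) = sqrt ((norm x)\<^sup>2 + (norm y)\<^sup>2)\<close>.\<close>

instantiation prod :: (complex_inner, complex_inner) complex_inner
begin

definition scaleC_prod_def: "c *\<^sub>C z = (c *\<^sub>C fst z, c *\<^sub>C snd z)"

definition cinner_prod_def: "cinner z w = cinner (fst z) (fst w) + cinner (snd z) (snd w)"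

instance
proof
  fix x y z :: "'a \<times> 'b" and c d :: complex and s :: real
  show "c *\<^sub>C (x + y) = c *\<^sub>C x + c *\<^sub>C y"
    by (simp add: scaleC_prod_def scaleC_add_right)
  show "(c + d) *\<^sub>C x = c *\<^sub>C x + d *\<^sub>C x"
    by (simp add: scaleC_prod_def scaleC_add_left)
  show "c *\<^sub>C (d *\<^sub>C x) = (c * d) *\<^sub>C x"
    by (simp add: scaleC_prod_def scaleC_scaleC)
  show "complex_of_real s *\<^sub>C x = s *\<^sub>R x"
    by (simp add: scaleC_prod_def scaleC_of_real scaleR_prod_def)
  show "cinner x y = cnj (cinner y x)"
    unfolding cinner_prod_def complex_cnj_add
    using cinner_commute[of "fst x" "fst y"] cinner_commute[of "snd x" "snd y"] by simp
  show "cinner (x + y) z = cinner x z + cinner y z"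
    by (simp add: cinner_prod_def cinner_add_left)
  show "cinner (c *\<^sub>C x) y = c * cinner x y"
    by (simp add: cinner_prod_def scaleC_prod_def cinner_scaleC_left distrib_left)
  show "inner x y = Re (cinner x y)"
    by (simp add: cinner_prod_def inner_prod_def inner_eq_Re_cinner)
qed

end

instance prod :: (chilbert_space, chilbert_space) chilbert_space ..

text \<open>Bounded operators are functions satisfying \<open>bounded_clinear\<close>; their operator norm is the
  library's \<^const>\<open>onorm\<close>.\<close>

definition bounded_clinear :: "('a::complex_inner \<Rightarrow> 'b::complex_inner) \<Rightarrow> bool" where
  "bounded_clinear A \<longleftrightarrow> bounded_linear A \<and> (\<forall>c x. A (c *\<^sub>C x) = c *\<^sub>C A x)"

definition cadjoint :: "('a::chilbert_space \<Rightarrow> 'b::chilbert_space) \<Rightarrow> 'b \<Rightarrow> 'a" where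
  "cadjoint A = (THE B. \<forall>x y. cinner (A x) y = cinner x (B y))"

definition numerical_radius :: "('a::complex_inner \<Rightarrow> 'a) \<Rightarrow> real" where
  "numerical_radius A = (SUP x\<in>{x. norm x = 1}. cmod (cinner (A x) x))"

definition spectrum :: "('a::complex_inner \<Rightarrow> 'a) \<Rightarrow> complex set" where
  "spectrum A = {c. \<not> (\<exists>B. bounded_clinear B \<and>
     (\<forall>x. B (A x - c *\<^sub>C x) = x) \<and> (\<forall>x. A (B x) - c *\<^sub>C B x = x))}"

definition poly_op :: "real poly \<Rightarrow> ('a::real_vector \<Rightarrow> 'a) \<Rightarrow> 'a \<Rightarrow> 'a" where
  "poly_op p A x = (\<Sum>i\<le>degree p. coeff p i *\<^sub>R (A ^^ i) x)"

text \<open>Continuous functional calculus of a self-adjoint operator \<open>A\<close>: \<open>h(A)\<close> is the norm limit of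
  \<open>p n (A)\<close> for real polynomials \<open>p n\<close> converging to \<open>h\<close> uniformly on the spectrum of \<open>A\<close>, which
  is real. Only the values of \<open>h\<close> on the spectrum matter.\<close>

definition cfc :: "(real \<Rightarrow> real) \<Rightarrow> ('a::chilbert_space \<Rightarrow> 'a) \<Rightarrow> 'a \<Rightarrow> 'a" where
  "cfc h A = (THE B. bounded_clinear B \<and>
     (\<exists>p. uniform_limit {t. complex_of_real t \<in> spectrum A} (\<lambda>n. poly (p n)) h sequentially \<and>
          (\<lambda>n. onorm (\<lambda>x. poly_op (p n) A x - B x)) \<longlonglongrightarrow> 0))"

definition op_abs :: "('a::chilbert_space \<Rightarrow> 'b::chilbert_space) \<Rightarrow> 'a \<Rightarrow> 'a" where
  "op_abs A = cfc sqrt (cadjoint A \<circ> A)"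

end

theory Submission
  imports Defs "HOL-Computational_Algebra.Fundamental_Theorem_Algebra"
begin

text \<open>
  For a unit vector \<open>(x\<^sub>1, x\<^sub>2)\<close> the number \<open>\<langle>T x, x\<rangle>\<close> is \<open>\<langle>X x\<^sub>2, x\<^sub>1\<rangle> + \<langle>Y x\<^sub>1, x\<^sub>2\<rangle>\<close>. Each summand is
  controlled by the mixed Schwarz inequality
  \<open>|\<langle>X x, y\<rangle>| \<le> \<parallel>f(|X|) x\<parallel> \<parallel>g(|X\<^sup>*|) y\<parallel>\<close> (\<open>mixed_schwarz\<close>). Convexity of \<open>t \<mapsto> t\<^sup>r\<close> splits the
  \<open>r\<close>-th power of the sum at the price of \<open>2\<close> to the power \<open>r - 1\<close> (\<open>powr_add_le\<close>), and McCarthy's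
  inequality moves the power \<open>r\<close> inside the quadratic forms (\<open>mccarthy\<close>). With
  \<open>p = \<langle>P x\<^sub>2, x\<^sub>2\<rangle>\<close> and \<open>q = \<langle>Q x\<^sub>1, x\<^sub>1\<rangle>\<close> the Cauchy--Schwarz inequality in the plane leaves
  \<open>\<surd>p \<surd>q\<close>, and \<open>2 \<surd>p \<surd>q = p + q - (\<surd>p - \<surd>q)\<^sup>2\<close> produces the subtracted term \<open>\<zeta>\<close>.

  All of this rests on the continuous functional calculus of a positive operator, which is
  developed from the definitions. The decisive fact is that a real polynomial \<open>p\<close> which is
  nonnegative on the spectrum of a self-adjoint \<open>A\<close> gives a positive operator \<open>p(A)\<close>
  (\<open>poly_op_nonneg\<close>). The infimum \<open>m\<close> of the quadratic form of \<open>p(A)\<close> makes \<open>p(A) - m\<close> fail to be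
  bounded below, so one of its irreducible factors fails; a factor with nonreal roots never does,
  since \<open>A\<close> is self-adjoint, so there is a real root \<open>c\<close> of \<open>p - m\<close> in the spectrum, and
  \<open>m = p(c) \<ge> 0\<close>. Applied to \<open>M\<^sup>2 - p\<^sup>2\<close> this bounds the norm of \<open>p(A)\<close> by the supremum of \<open>|p|\<close> on
  the spectrum, and Weierstrass approximation extends the calculus to continuous functions.

  Real parts of complex inner products are real inner products, so self-adjointness, positivity and
  the norm estimates are all handled with the real inner product; complex linearity is only carried
  along.
\<close>

instance chilbert_space \<subseteq> banach ..

section \<open>Bounded complex-linear operators and adjoints\<close>

lemma bounded_clinear_bounded_linear: "bounded_clinear A \<Longrightarrow> bounded_linear A"
  by (simp add: bounded_clinear_def)

lemma bounded_clinear_ident: "bounded_clinear (\<lambda>x. x)"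
  by (simp add: bounded_clinear_def bounded_linear_ident)

lemma bounded_clinear_zero: "bounded_clinear (\<lambda>x::'a::complex_inner. 0 :: 'b::complex_inner)"
proof -
  have "c *\<^sub>C (0::'b) = 0" for c
    using scaleC_add_right[of c 0 "0::'b"] by simp
  then show ?thesis by (simp add: bounded_clinear_def bounded_linear_zero)
qed

lemma bounded_clinear_compose:
  "bounded_clinear A \<Longrightarrow> bounded_clinear B \<Longrightarrow> bounded_clinear (\<lambda>x. A (B x))"
  by (simp add: bounded_clinear_def bounded_linear_compose)

lemma bounded_clinear_add:
  "bounded_clinear A \<Longrightarrow> bounded_clinear B \<Longrightarrow> bounded_clinear (\<lambda>x. A x + B x)"
  by (simp add: bounded_clinear_def bounded_linear_add scaleC_add_right)

lemma scaleC_scaleR: "c *\<^sub>C (s *\<^sub>R x) = s *\<^sub>R (c *\<^sub>C x)"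
  by (metis scaleC_of_real scaleC_scaleC mult.commute)

lemma bounded_clinear_scaleR:
  "bounded_clinear A \<Longrightarrow> bounded_clinear (\<lambda>x. s *\<^sub>R A x)"
  by (simp add: bounded_clinear_def bounded_linear_const_scaleR scaleC_scaleR)

lemma bounded_clinear_sum:
  assumes "\<And>i. i \<in> I \<Longrightarrow> bounded_clinear (F i)"
  shows "bounded_clinear (\<lambda>x. \<Sum>i\<in>I. F i x)"
  using assms
  by (induction I rule: infinite_finite_induct) (auto simp: bounded_clinear_zero bounded_clinear_add)

lemma cinner_scaleC_right: "cinner x (c *\<^sub>C y) = cnj c * cinner x y"
  by (metis cinner_commute cinner_scaleC_left complex_cnj_mult)

lemma Im_cinner: "Im (cinner x y) = inner x (\<i> *\<^sub>C y)"
  by (simp add: inner_eq_Re_cinner cinner_scaleC_right)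

lemma inner_scaleC_ii: "inner (\<i> *\<^sub>C x) y = - inner x (\<i> *\<^sub>C y)"
  by (simp add: inner_eq_Re_cinner cinner_scaleC_right cinner_scaleC_left)

lemma cinner_eq_iff: "(\<forall>y. cinner y u = cinner y v) \<longleftrightarrow> u = v"
proof
  assume *: "\<forall>y. cinner y u = cinner y v"
  then have "inner (u - v) (u - v) = 0"
    unfolding inner_diff_right by (simp add: inner_eq_Re_cinner)
  then show "u = v" by simp
qed simp

text \<open>A unimodular factor turns the modulus of a complex inner product into a real inner product.\<close>

lemma cmod_cinner_obtain_unimodular:
  obtains c where "cmod c = 1" "cmod (cinner x y) = inner (c *\<^sub>C x) y"
proof (cases "cinner x y = 0")
  case True
  show ?thesis by (rule that[of 1]) (simp_all add: True inner_eq_Re_cinner cinner_scaleC_left)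
next
  case False
  show ?thesis
  proof (rule that[of "cnj (sgn (cinner x y))"])
    show "cmod (cnj (sgn (cinner x y))) = 1" using False by (simp add: norm_sgn)
    have "cnj (sgn z) * z = of_real (cmod z)" for z
      by (cases "z = 0")
        (simp_all add: sgn_eq complex_norm_square[symmetric] mult.commute power2_eq_square)
    then show "cmod (cinner x y) = inner (cnj (sgn (cinner x y)) *\<^sub>C x) y"
      by (simp add: inner_eq_Re_cinner cinner_scaleC_left)
  qed
qed

lemma norm_scaleC: "norm (c *\<^sub>C x) = cmod c * norm (x :: 'a::complex_inner)"
proof -
  have "(norm (c *\<^sub>C x))\<^sup>2 = Re (c * cnj c * cinner x x)"
    by (simp only: power2_norm_eq_inner inner_eq_Re_cinner cinner_scaleC_left cinner_scaleC_right mult.assoc)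
       (simp add: mult.left_commute)
  also have "\<dots> = (cmod c * norm x)\<^sup>2"
    by (simp add: complex_norm_square[symmetric] power2_norm_eq_inner[of x] inner_eq_Re_cinner
        power_mult_distrib del: of_real_power add: of_real_power[symmetric])
  finally show ?thesis by (simp add: power2_eq_iff_nonneg)
qed

text \<open>The functional \<open>J x = \<parallel>x\<parallel>\<^sup>2 / 2 - \<phi> x\<close> is bounded below. By the parallelogram law a minimising
  sequence is Cauchy, and the derivative of \<open>J\<close> vanishes at its limit \<open>v\<close>, which says that \<open>v\<close>
  represents \<open>\<phi>\<close>.\<close>

lemma riesz_representation:
  fixes \<phi> :: "'a::{real_inner, complete_space} \<Rightarrow> real"
  assumes "bounded_linear \<phi>"
  obtains v where "\<And>y. \<phi> y = inner v y"
proof -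
  interpret \<phi>: bounded_linear \<phi> by fact
  define J where "J x = (norm x)\<^sup>2 / 2 - \<phi> x" for x
  obtain K where K: "\<And>x. norm (\<phi> x) \<le> norm x * K"
    using \<phi>.bounded by blast
  have below: "- K\<^sup>2 / 2 \<le> J x" for x
    using K[of x] sum_squares_bound[of "norm x" K] by (simp add: J_def)
  define m where "m = Inf (range J)"
  have bdd: "bdd_below (range J)"
    using below by (intro bdd_belowI[of _ "- K\<^sup>2 / 2"]) auto
  have m: "m \<le> J x" for x
    unfolding m_def using bdd by (simp add: cInf_lower)
  have "\<exists>x. J x < m + inverse (Suc n)" for n
    using cInf_lessD[of "range J" "m + inverse (Suc n)"] by (auto simp: m_def)
  then obtain u where u: "\<And>n. J (u n) < m + inverse (Suc n)" by metis
  have par: "(norm (x - y))\<^sup>2 / 4 = J x + J y - 2 * J ((1/2) *\<^sub>R (x + y))" for x y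
    by (simp add: J_def power2_norm_eq_inner inner_simps \<phi>.add \<phi>.scaleR inner_commute field_simps)
  have cau: "(norm (u k - u n))\<^sup>2 \<le> 4 * inverse (Suc k) + 4 * inverse (Suc n)" for k n
    using par[of "u k" "u n"] u[of k] u[of n] m[of "(1/2) *\<^sub>R (u k + u n)"] by linarith
  have "Cauchy u"
  proof (rule metric_CauchyI)
    fix e :: real assume e: "e > 0"
    obtain N where N: "inverse (Suc N) < e\<^sup>2 / 8"
      using reals_Archimedean[of "e\<^sup>2 / 8"] e by auto
    have "dist (u k) (u n) < e" if "k \<ge> N" "n \<ge> N" for k n
    proof -
      have "inverse (real (Suc k)) \<le> inverse (Suc N)" "inverse (real (Suc n)) \<le> inverse (Suc N)"
        using that by (simp_all add: field_simps)
      then have "(norm (u k - u n))\<^sup>2 < e\<^sup>2" using cau[of k n] N by linarith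
      then show ?thesis using e by (simp add: dist_norm power_less_imp_less_base)
    qed
    then show "\<exists>N. \<forall>k\<ge>N. \<forall>n\<ge>N. dist (u k) (u n) < e" by blast
  qed
  then obtain v where v: "u \<longlonglongrightarrow> v" using Cauchy_convergent convergent_def by blast
  have "(\<lambda>n. J (u n)) \<longlonglongrightarrow> J v"
    unfolding J_def by (intro tendsto_intros v \<phi>.tendsto) simp
  moreover have "(\<lambda>n. m + inverse (Suc n)) \<longlonglongrightarrow> m + 0"
    by (intro tendsto_intros LIMSEQ_inverse_real_of_nat)
  ultimately have "J v \<le> m + 0"
    by (rule LIMSEQ_le) (use u in \<open>blast intro: less_imp_le\<close>)
  then have Jv: "J v \<le> m" by simp
  have "\<phi> y = inner v y" for y
  proof -
    \<comment> \<open>A short step against the derivative \<open>d\<close> would push \<open>J\<close> below its infimum unless \<open>d = 0\<close>; the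
      summand 1 keeps the denominator positive for \<open>y = 0\<close>.\<close>
    define d where "d = inner v y - \<phi> y"
    define t where "t = - d / ((norm y)\<^sup>2 + 1)"
    have "J (v + t *\<^sub>R y) = J v + t * d + t\<^sup>2 / 2 * (norm y)\<^sup>2"
      by (simp add: J_def d_def power2_norm_eq_inner inner_simps \<phi>.add \<phi>.scaleR inner_commute
          power2_eq_square[of t] algebra_simps add_divide_distrib diff_divide_distrib)
    then have 1: "0 \<le> t * d + t\<^sup>2 / 2 * (norm y)\<^sup>2"
      using Jv m[of "v + t *\<^sub>R y"] by linarith
    have 2: "t\<^sup>2 / 2 * (norm y)\<^sup>2 \<le> t\<^sup>2 / 2 * ((norm y)\<^sup>2 + 1)"
      by (intro mult_left_mono) auto
    have 3: "t * ((norm y)\<^sup>2 + 1) = - d"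
      by (simp add: t_def add_nonneg_eq_0_iff)
    have "t\<^sup>2 / 2 * ((norm y)\<^sup>2 + 1) = - (t * d) / 2"
      by (simp only: power2_eq_square[of t] times_divide_eq_left mult.assoc 3)
    then have "0 \<le> t * d" using 1 2 by linarith
    moreover have "t * d = - (d\<^sup>2 / ((norm y)\<^sup>2 + 1))"
      by (simp add: t_def power2_eq_square)
    ultimately have "d\<^sup>2 / ((norm y)\<^sup>2 + 1) \<le> 0" by linarith
    then have "d = 0" by (simp add: divide_le_0_iff add_nonneg_pos) (smt (verit) zero_le_power2)
    then show ?thesis by (simp add: d_def)
  qed
  then show ?thesis by (rule that)
qed

text \<open>Riesz representation for the real inner product yields a real adjoint. Complex linearity of \<open>A\<close>
  transfers the identity to imaginary parts, as \<open>Im (cinner x y)\<close> is the real inner product of \<open>x\<close>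
  with \<open>\<i> y\<close>.\<close>

lemma cadjoint:
  fixes A :: "'a::chilbert_space \<Rightarrow> 'b::chilbert_space"
  assumes "bounded_clinear A"
  shows cinner_cadjoint: "cinner (A x) y = cinner x (cadjoint A y)"
    and bounded_clinear_cadjoint: "bounded_clinear (cadjoint A)"
proof -
  interpret A: bounded_linear A using assms by (rule bounded_clinear_bounded_linear)
  have scaleC: "A (c *\<^sub>C x) = c *\<^sub>C A x" for c x
    using assms by (simp add: bounded_clinear_def)
  have "\<exists>v. \<forall>x. inner (A x) y = inner v x" for y
  proof -
    have "bounded_linear (\<lambda>x. inner (A x) y)"
      by (intro bounded_linear_inner_left_comp A.bounded_linear_axioms)
    then show ?thesis by (metis riesz_representation)
  qed
  then obtain B where B: "\<And>x y. inner (A x) y = inner (B y) x" by metis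
  have cB: "cinner (A x) y = cinner x (B y)" for x y
  proof (rule complex_eqI)
    show "Re (cinner (A x) y) = Re (cinner x (B y))"
      using B[of x y] by (simp add: inner_commute flip: inner_eq_Re_cinner)
    have "inner (A x) (\<i> *\<^sub>C y) = - inner (A (\<i> *\<^sub>C x)) y"
      by (simp add: scaleC inner_scaleC_ii)
    also have "\<dots> = - inner (\<i> *\<^sub>C x) (B y)" by (simp add: B inner_commute[of _ "B y"])
    also have "\<dots> = inner x (\<i> *\<^sub>C B y)" by (simp add: inner_scaleC_ii)
    finally show "Im (cinner (A x) y) = Im (cinner x (B y))" by (simp add: Im_cinner)
  qed
  have eq: "cadjoint A = B"
    unfolding cadjoint_def
  proof (rule the_equality)
    show "\<forall>x y. cinner (A x) y = cinner x (B y)" using cB by blast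
    show "C = B" if "\<forall>x y. cinner (A x) y = cinner x (C y)" for C
      using that cB by (metis cinner_eq_iff ext)
  qed
  show "cinner (A x) y = cinner x (cadjoint A y)" by (simp add: eq cB)
  have addr: "cinner x (y + z) = cinner x y + cinner x z" for x y z :: 'a
    by (metis cinner_commute cinner_add_left complex_cnj_add)
  have addr': "cinner x (y + z) = cinner x y + cinner x z" for x y z :: 'b
    by (metis cinner_commute cinner_add_left complex_cnj_add)
  obtain K where K: "K > 0" "\<And>x. norm (A x) \<le> norm x * K"
    using A.pos_bounded by blast
  have "norm (B y) \<le> norm y * K" for y
  proof (cases "B y = 0")
    case False
    have "(norm (B y))\<^sup>2 = inner (A (B y)) y" by (simp add: B power2_norm_eq_inner)
    also have "\<dots> \<le> norm (A (B y)) * norm y" by (rule norm_cauchy_schwarz)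
    also have "\<dots> \<le> norm (B y) * K * norm y" by (intro mult_right_mono K) auto
    finally show ?thesis using False by (simp add: power2_eq_square mult_ac)
  qed (use K in simp)
  moreover have "B (y + z) = B y + B z" for y z
    by (subst cinner_eq_iff[symmetric]) (simp add: addr addr' flip: cB)
  moreover have C: "B (c *\<^sub>C y) = c *\<^sub>C B y" for c y
    by (subst cinner_eq_iff[symmetric]) (simp add: cinner_scaleC_right flip: cB)
  moreover have "B (s *\<^sub>R y) = s *\<^sub>R B y" for s y
    using C[of "complex_of_real s" y] by (simp add: scaleC_of_real)
  ultimately show "bounded_clinear (cadjoint A)"
    unfolding eq bounded_clinear_def by (intro conjI allI bounded_linear_intro) auto
qed

lemma inner_cadjoint:
  "bounded_clinear A \<Longrightarrow> inner (A x) y = inner x (cadjoint A y)"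
  by (simp add: inner_eq_Re_cinner cinner_cadjoint)

lemma inner_cadjoint_left:
  "bounded_clinear A \<Longrightarrow> inner (cadjoint A y) x = inner y (A x)"
  by (metis inner_cadjoint inner_commute)

lemma cadjoint_cadjoint:
  assumes "bounded_clinear A"
  shows "cadjoint (cadjoint A) = A"
proof
  fix x
  have "inner y (cadjoint (cadjoint A) x - A x) = 0" for y
    using inner_cadjoint[OF bounded_clinear_cadjoint[OF assms], of y x] inner_cadjoint_left[OF assms, of y x]
    by (simp add: inner_diff_right)
  then show "cadjoint (cadjoint A) x = A x"
    using inner_eq_zero_iff by (metis eq_iff_diff_eq_0)
qed

section \<open>Polynomials in an operator\<close>

lemma poly_op_alt:
  assumes "degree p \<le> N"
  shows "poly_op p A x = (\<Sum>i\<le>N. coeff p i *\<^sub>R (A ^^ i) x)"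
  unfolding poly_op_def using assms
  by (intro sum.mono_neutral_left) (auto simp: coeff_eq_0)

lemma poly_op_0: "poly_op 0 A x = 0"
  by (simp add: poly_op_def)

lemma poly_op_add: "poly_op (p + q) A x = poly_op p A x + poly_op q A x"
proof -
  define N where "N = max (degree p) (degree q)"
  have "degree (p + q) \<le> N" by (simp add: N_def degree_add_le_max)
  moreover have "degree p \<le> N" "degree q \<le> N" by (simp_all add: N_def)
  ultimately show ?thesis
    by (simp add: poly_op_alt[of _ N] scaleR_add_left sum.distrib)
qed

lemma poly_op_smult: "poly_op (smult c p) A x = c *\<^sub>R poly_op p A x"
  using poly_op_alt[of "smult c p" "degree p" A x] degree_smult_le[of c p]
  by (simp add: poly_op_def[of p] scaleR_sum_right)

lemma poly_op_diff: "poly_op (p - q) A x = poly_op p A x - poly_op q A x"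
  using poly_op_add[of p "smult (-1) q" A x] poly_op_smult[of "-1" q A x] by simp

lemma poly_op_pCons:
  assumes "linear A"
  shows "poly_op (pCons a p) A x = a *\<^sub>R x + A (poly_op p A x)"
proof -
  interpret linear A by fact
  have "poly_op (pCons a p) A x = (\<Sum>i\<le>Suc (degree p). coeff (pCons a p) i *\<^sub>R (A ^^ i) x)"
    by (rule poly_op_alt) (simp add: degree_pCons_le)
  also have "\<dots> = a *\<^sub>R x + (\<Sum>i\<le>degree p. coeff p i *\<^sub>R A ((A ^^ i) x))"
    by (subst sum.atMost_Suc_shift) simp
  also have "\<dots> = a *\<^sub>R x + A (poly_op p A x)"
    by (simp add: poly_op_def sum scale)
  finally show ?thesis .
qed

lemma poly_op_mult:
  assumes "linear A"
  shows "poly_op (p * q) A x = poly_op p A (poly_op q A x)"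
proof (induction p)
  case 0
  then show ?case by (simp add: poly_op_0)
next
  case (pCons a p)
  then show ?case
    by (simp add: poly_op_add poly_op_smult poly_op_pCons[OF assms])
qed

lemma bounded_clinear_poly_op:
  assumes "bounded_clinear A"
  shows "bounded_clinear (poly_op p A)"
proof -
  have "bounded_clinear (A ^^ i)" for i
  proof (induction i)
    case 0
    then show ?case by (simp add: bounded_clinear_ident id_def)
  next
    case (Suc i)
    then show ?case using bounded_clinear_compose[OF assms] by (simp add: o_def)
  qed
  then show ?thesis
    unfolding poly_op_def by (intro bounded_clinear_sum bounded_clinear_scaleR)
qed

lemma poly_op_intertwine:
  assumes "linear A" "linear B" "linear X" "\<And>x. X (A x) = B (X x)"
  shows "X (poly_op p A x) = poly_op p B (X x)"
proof (induction p)
  case 0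
  then show ?case using linear_0[OF \<open>linear X\<close>] by (simp add: poly_op_0)
next
  case (pCons a p)
  then show ?case
    using assms by (simp add: poly_op_pCons linear_add linear_scale)
qed

text \<open>Self-adjointness is expressed with the real inner product; for complex-linear operators this
  agrees with the complex notion, and it keeps the arguments below real.\<close>

definition selfadjoint :: "('a::complex_inner \<Rightarrow> 'a) \<Rightarrow> bool" where
  "selfadjoint A \<longleftrightarrow> bounded_clinear A \<and> (\<forall>x y. inner (A x) y = inner x (A y))"

definition positive_op :: "('a::complex_inner \<Rightarrow> 'a) \<Rightarrow> bool" where
  "positive_op A \<longleftrightarrow> selfadjoint A \<and> (\<forall>x. 0 \<le> inner (A x) x)"

definition bounded_below :: "('a::real_normed_vector \<Rightarrow> 'b::real_normed_vector) \<Rightarrow> bool" where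
  "bounded_below A \<longleftrightarrow> (\<exists>\<delta>>0. \<forall>x. \<delta> * norm x \<le> norm (A x))"

lemma selfadjoint_bounded_clinear: "selfadjoint A \<Longrightarrow> bounded_clinear A"
  by (simp add: selfadjoint_def)

lemma selfadjoint_linear: "selfadjoint A \<Longrightarrow> linear A"
  by (simp add: selfadjoint_def bounded_clinear_def bounded_linear.linear)

lemma selfadjoint_poly_op:
  assumes "selfadjoint A"
  shows "selfadjoint (poly_op p A)"
proof -
  have "inner (poly_op p A x) y = inner x (poly_op p A y)" for x y
  proof (induction p arbitrary: x y)
    case 0
    then show ?case by (simp add: poly_op_0)
  next
    case (pCons a p)
    have "inner (A (poly_op p A x)) y = inner (poly_op p A x) (A y)"
      using assms by (simp add: selfadjoint_def)
    also have "\<dots> = inner x (A (poly_op p A y))"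
      using poly_op_intertwine[of A A A p y] pCons assms by (simp add: selfadjoint_linear)
    finally show ?case
      using assms by (simp add: poly_op_pCons selfadjoint_linear inner_simps)
  qed
  then show ?thesis
    using assms by (simp add: selfadjoint_def bounded_clinear_poly_op)
qed

lemma bounded_below_compose:
  assumes "bounded_below A" "bounded_below B"
  shows "bounded_below (\<lambda>x. A (B x))"
proof -
  from assms obtain a b where *: "a > 0" "\<And>x. a * norm x \<le> norm (A x)"
      "b > 0" "\<And>x. b * norm x \<le> norm (B x)"
    unfolding bounded_below_def by blast
  have "a * b * norm x \<le> norm (A (B x))" for x
    using order_trans[OF mult_left_mono[OF *(4)[of x], of a] *(2)[of "B x"]] *(1)
    by (simp add: mult.assoc)
  then show ?thesis unfolding bounded_below_def using * by (intro exI[of _ "a * b"]) simp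
qed

lemma bounded_below_of_inner_ge:
  assumes "\<epsilon> > 0" "\<And>x. \<epsilon> * (norm x)\<^sup>2 \<le> inner (A x) x"
  shows "\<epsilon> * norm x \<le> norm (A x)"
proof (cases "x = 0")
  case False
  have "\<epsilon> * norm x * norm x \<le> norm (A x) * norm x"
    using assms(2)[of x] norm_cauchy_schwarz[of "A x" x] by (simp add: power2_eq_square mult_ac)
  then show ?thesis using False by simp
qed simp

text \<open>A nonreal root of a real polynomial comes with its conjugate; the remainder modulo the
  corresponding real quadratic vanishes because it has degree at most one and a nonreal root.\<close>

lemma real_poly_divisor:
  fixes p :: "real poly"
  assumes "degree p > 0"
  obtains c where "[:-c, 1:] dvd p" | a b where "b \<noteq> 0" "[:a\<^sup>2 + b\<^sup>2, - 2 * a, 1:] dvd p"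
proof -
  define ev where "ev q z = poly (map_poly complex_of_real q) z" for q z
  have ev_pCons: "ev (pCons a q) z = of_real a + z * ev q z" for a q z
    by (simp add: ev_def map_poly_pCons)
  have ev_0: "ev 0 z = 0" for z by (simp add: ev_def)
  have ev_add: "ev (q + r) z = ev q z + ev r z" for q r z
    by (induction q r rule: poly_induct2) (simp_all add: ev_0 ev_pCons algebra_simps)
  have ev_smult: "ev (smult c q) z = of_real c * ev q z" for c q z
    by (induction q) (simp_all add: ev_0 ev_pCons algebra_simps)
  have ev_mult: "ev (q * r) z = ev q z * ev r z" for q r z
    by (induction q) (simp_all add: ev_0 ev_pCons ev_add ev_smult algebra_simps)
  have ev_real: "ev q (of_real x) = of_real (poly q x)" for q x
    by (induction q) (simp_all add: ev_0 ev_pCons)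
  have "degree (map_poly complex_of_real p) > 0"
    using assms by (simp add: degree_map_poly)
  then have "\<exists>z. poly (map_poly complex_of_real p) z = 0"
    by (intro fundamental_theorem_of_algebra_alt) auto
  then obtain z where z: "ev p z = 0" by (auto simp: ev_def)
  show thesis
  proof (cases "Im z = 0")
    case True
    then have "z = of_real (Re z)" by (simp add: complex_eq_iff)
    then have "poly p (Re z) = 0" using z ev_real[of p "Re z"] by simp
    then show thesis using that(1)[of "Re z"] by (simp add: poly_eq_0_iff_dvd)
  next
    case False
    define d where "d = [:(Re z)\<^sup>2 + (Im z)\<^sup>2, - 2 * Re z, 1:]"
    have d: "ev d z = 0"
      by (simp add: d_def ev_pCons ev_0 complex_eq_iff power2_eq_square algebra_simps)
    have "degree d = 2" "d \<noteq> 0" by (simp_all add: d_def)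
    then have "degree (p mod d) < 2"
      using degree_mod_less'[of d p] by (cases "p mod d = 0") auto
    then have "p mod d = [:coeff (p mod d) 0, coeff (p mod d) 1:]"
      by (intro poly_eqI) (auto simp: coeff_pCons coeff_eq_0 split: nat.split)
    then obtain u v where uv: "p mod d = [:u, v:]" by blast
    have "ev (d * (p div d) + p mod d) z = 0" using z by simp
    then have "of_real u + z * of_real v = 0"
      unfolding ev_add ev_mult d uv by (simp add: ev_pCons ev_0)
    then have "u = 0 \<and> v = 0"
      using False by (auto simp: complex_eq_iff)
    then have "d dvd p" by (simp add: uv dvd_eq_mod_eq_0)
    then show thesis using that(2)[OF False, of "Re z"] by (simp add: d_def)
  qed
qed

text \<open>Split off one irreducible factor after the other: linear factors are bounded below by hypothesis,
  and a quadratic factor without real roots is bounded below for every self-adjoint operator.\<close>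

lemma bounded_below_poly_op:
  assumes A: "selfadjoint A" and "p \<noteq> 0"
    and "\<And>c. poly p c = 0 \<Longrightarrow> bounded_below (\<lambda>x. A x - c *\<^sub>R x)"
  shows "bounded_below (poly_op p A)"
  using assms(2,3)
proof (induction "degree p" arbitrary: p rule: less_induct)
  case less
  note lin = selfadjoint_linear[OF A]
  show ?case
  proof (cases "degree p = 0")
    case True
    then obtain a where "p = [:a:]" by (rule degree_eq_zeroE)
    then show ?thesis
      using less.prems(1) unfolding bounded_below_def
      by (intro exI[of _ "\<bar>a\<bar>"]) (simp add: poly_op_pCons[OF lin] poly_op_0 linear_0[OF lin])
  next
    case False
    have step: "bounded_below (poly_op p A)"
      if d: "d dvd p" "degree d > 0" "bounded_below (poly_op d A)" for d
    proof -
      from d obtain q where q: "p = d * q" by blast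
      with less.prems have "d \<noteq> 0" "q \<noteq> 0" by auto
      then have "degree q < degree p" using q d by (simp add: degree_mult_eq)
      then have "bounded_below (poly_op q A)"
        by (rule less.hyps) (use q \<open>q \<noteq> 0\<close> less.prems(2) in auto)
      with d show ?thesis
        using bounded_below_compose[of "poly_op d A" "poly_op q A"]
        by (simp add: q poly_op_mult[OF lin] bounded_below_def)
    qed
    from False have "degree p > 0" by simp
    then show ?thesis
    proof (cases rule: real_poly_divisor)
      case (1 c)
      have "poly_op [:-c, 1:] A = (\<lambda>x. A x - c *\<^sub>R x)"
        by (rule ext) (simp add: poly_op_pCons[OF lin] poly_op_0 linear_0[OF lin])
      moreover have "poly p c = 0" using 1 by (simp add: poly_eq_0_iff_dvd)
      ultimately show ?thesis using step[OF 1] less.prems(2)[of c] by simp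
    next
      case (2 a b)
      let ?d = "[:a\<^sup>2 + b\<^sup>2, - 2 * a, 1:]"
      have ev: "poly_op ?d A x = (a\<^sup>2 + b\<^sup>2) *\<^sub>R x - (2 * a) *\<^sub>R A x + A (A x)" for x
        by (simp add: poly_op_pCons[OF lin] poly_op_0 linear_0[OF lin] linear_add[OF lin]
            linear_scale[OF lin] linear_diff[OF lin] linear_neg[OF lin])
      \<comment> \<open>The quadratic is \<open>(t - a)\<^sup>2 + b\<^sup>2\<close>, so its quadratic form dominates \<open>b\<^sup>2\<close>.\<close>
      have "inner (poly_op ?d A x) x = (norm (A x - a *\<^sub>R x))\<^sup>2 + b\<^sup>2 * (norm x)\<^sup>2" for x
      proof -
        have "inner (A (A x)) x = inner (A x) (A x)" using A by (simp add: selfadjoint_def)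
        then show ?thesis
          unfolding ev
          by (simp add: power2_norm_eq_inner inner_simps inner_commute
              power2_eq_square[of a] algebra_simps)
      qed
      then have "b\<^sup>2 * norm x \<le> norm (poly_op ?d A x)" for x
        by (intro bounded_below_of_inner_ge) (use 2 in auto)
      then have "bounded_below (poly_op ?d A)"
        unfolding bounded_below_def using 2 by (intro exI[of _ "b\<^sup>2"]) auto
      then show ?thesis using step[OF 2(2)] by simp
    qed
  qed
qed

section \<open>The real spectrum\<close>

abbreviation real_spectrum :: "('a::complex_inner \<Rightarrow> 'a) \<Rightarrow> real set" where
  "real_spectrum A \<equiv> {t. complex_of_real t \<in> spectrum A}"

lemma bounded_below_of_not_in_spectrum:
  assumes "c \<notin> real_spectrum A"
  shows "bounded_below (\<lambda>x. A x - c *\<^sub>R x)"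
proof -
  from assms obtain B where B: "bounded_clinear B" "\<And>x. B (A x - c *\<^sub>R x) = x"
    by (auto simp: spectrum_def scaleC_of_real)
  interpret B: bounded_linear B using B(1) by (rule bounded_clinear_bounded_linear)
  obtain K where K: "K > 0" "\<And>x. norm (B x) \<le> norm x * K"
    using B.pos_bounded by blast
  have "inverse K * norm x \<le> norm (A x - c *\<^sub>R x)" for x
    using K(2)[of "A x - c *\<^sub>R x"] K(1) by (simp add: B(2) field_simps)
  then show ?thesis unfolding bounded_below_def using K(1) by (intro exI[of _ "inverse K"]) simp
qed

text \<open>The real Lax--Milgram theorem: for small \<open>\<tau>\<close> the map \<open>x \<mapsto> x - \<tau> (S x - y)\<close> is a
  contraction, and its fixed point solves \<open>S x = y\<close>.\<close>

lemma lax_milgram: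
  fixes S :: "'a::chilbert_space \<Rightarrow> 'a"
  assumes S: "bounded_clinear S" and eps: "\<epsilon> > 0" "\<And>x. \<epsilon> * (norm x)\<^sup>2 \<le> inner (S x) x"
  obtains B where "bounded_clinear B" "\<And>x. B (S x) = x" "\<And>x. S (B x) = x"
proof -
  interpret S: bounded_linear S using S by (rule bounded_clinear_bounded_linear)
  note below = bounded_below_of_inner_ge[of \<epsilon> S, OF eps]
  obtain K0 where K0: "K0 > 0" "\<And>x. norm (S x) \<le> norm x * K0"
    using S.pos_bounded by blast
  define K where "K = max K0 \<epsilon>"
  have K: "K > 0" "\<epsilon> \<le> K" "norm (S x) \<le> norm x * K" for x
    using K0(1) order_trans[OF K0(2)[of x] mult_left_mono[of K0 K "norm x"]]
    by (auto simp: K_def)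
  define \<tau> where "\<tau> = \<epsilon> / K\<^sup>2"
  define q where "q = sqrt (1 - \<epsilon>\<^sup>2 / K\<^sup>2)"
  have "\<epsilon>\<^sup>2 \<le> K\<^sup>2" using K eps by (intro power_mono) auto
  then have q: "0 \<le> q" "q < 1" "q\<^sup>2 = 1 - \<epsilon>\<^sup>2 / K\<^sup>2"
    using K eps by (auto simp: q_def)
  have contr: "norm (x - \<tau> *\<^sub>R S x) \<le> q * norm x" for x
  proof -
    have "(norm (x - \<tau> *\<^sub>R S x))\<^sup>2 = (norm x)\<^sup>2 - 2 * \<tau> * inner (S x) x + \<tau>\<^sup>2 * (norm (S x))\<^sup>2"
      by (simp add: power2_norm_eq_inner inner_simps inner_commute power2_eq_square[of \<tau>] algebra_simps)
    also have "\<dots> \<le> (norm x)\<^sup>2 - 2 * \<tau> * (\<epsilon> * (norm x)\<^sup>2) + \<tau>\<^sup>2 * (norm x * K)\<^sup>2"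
      using eps K by (intro add_mono diff_mono mult_left_mono power_mono order.refl) (auto simp: \<tau>_def)
    also have "\<dots> = (q * norm x)\<^sup>2"
    proof -
      have "\<tau> * \<epsilon> = \<epsilon>\<^sup>2 / K\<^sup>2" "\<tau>\<^sup>2 * K\<^sup>2 = \<epsilon>\<^sup>2 / K\<^sup>2"
        using K(1) by (simp_all add: \<tau>_def power2_eq_square)
      then have "1 - 2 * (\<tau> * \<epsilon>) + \<tau>\<^sup>2 * K\<^sup>2 = q\<^sup>2" by (simp add: q(3))
      moreover have "(norm x)\<^sup>2 - 2 * \<tau> * (\<epsilon> * (norm x)\<^sup>2) + \<tau>\<^sup>2 * (norm x * K)\<^sup>2
          = (1 - 2 * (\<tau> * \<epsilon>) + \<tau>\<^sup>2 * K\<^sup>2) * (norm x)\<^sup>2"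
        by (simp add: power_mult_distrib algebra_simps)
      ultimately show ?thesis by (simp add: power_mult_distrib)
    qed
    finally show ?thesis by (rule power2_le_imp_le) (simp add: q(1))
  qed
  have surj: "\<exists>x. S x = y" for y
  proof -
    define F where "F x = x - \<tau> *\<^sub>R (S x - y)" for x
    have "dist (F x) (F z) \<le> q * dist x z" for x z
    proof -
      have "F x - F z = (x - z) - \<tau> *\<^sub>R S (x - z)" by (simp add: F_def S.diff algebra_simps)
      then show ?thesis using contr[of "x - z"] by (simp add: dist_norm)
    qed
    then obtain x where "F x = x" using banach_fix_type[of q F] q by blast
    then have "S x = y" using K eps by (simp add: F_def \<tau>_def)
    then show ?thesis ..
  qed
  have inj: "x = z" if "S x = S z" for x z
    using below[of "x - z"] that eps by (simp add: S.diff zero_less_mult_iff mult_le_0_iff)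
  from surj obtain B where SB: "\<And>y. S (B y) = y" by metis
  have BS: "B (S x) = x" for x by (rule inj) (simp add: SB)
  have "norm (B y) \<le> norm y * inverse \<epsilon>" for y
    using below[of "B y"] eps by (simp add: SB field_simps)
  moreover have "B (y + z) = B y + B z" for y z by (rule inj) (simp add: SB S.add)
  moreover have "B (s *\<^sub>R y) = s *\<^sub>R B y" for s y by (rule inj) (simp add: SB S.scaleR)
  moreover have "B (c *\<^sub>C y) = c *\<^sub>C B y" for c y
    by (rule inj) (use S in \<open>simp add: SB bounded_clinear_def\<close>)
  ultimately have "bounded_clinear B"
    unfolding bounded_clinear_def by (intro conjI allI bounded_linear_intro) auto
  then show ?thesis using BS SB that by blast
qed

text \<open>For \<open>t < a\<close> the operator \<open>A - t\<close>, and for \<open>t > b\<close> the operator \<open>t - A\<close>, satisfies the hypothesis of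
  the Lax--Milgram theorem.\<close>

lemma real_spectrum_subset:
  fixes A :: "'a::chilbert_space \<Rightarrow> 'a"
  assumes A: "bounded_clinear A"
    and a: "\<And>x. a * (norm x)\<^sup>2 \<le> inner (A x) x"
    and b: "\<And>x. inner (A x) x \<le> b * (norm x)\<^sup>2"
  shows "real_spectrum A \<subseteq> {a..b}"
proof -
  have inv: "t \<notin> real_spectrum A"
    if s: "s \<noteq> 0" and eps: "\<epsilon> > 0" "\<And>x. \<epsilon> * (norm x)\<^sup>2 \<le> inner (s *\<^sub>R (A x - t *\<^sub>R x)) x" for s t \<epsilon>
  proof -
    have "bounded_clinear (\<lambda>x. s *\<^sub>R (A x + (-t) *\<^sub>R x))"
      by (intro bounded_clinear_scaleR bounded_clinear_add A bounded_clinear_ident)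
    then have "bounded_clinear (\<lambda>x. s *\<^sub>R (A x - t *\<^sub>R x))" by simp
    then obtain B where B: "bounded_clinear B" "\<And>x. B (s *\<^sub>R (A x - t *\<^sub>R x)) = x"
        "\<And>x. s *\<^sub>R (A (B x) - t *\<^sub>R B x) = x"
      using lax_milgram[OF _ eps] by metis
    interpret B: bounded_linear B using B(1) by (rule bounded_clinear_bounded_linear)
    interpret A: bounded_linear A using A by (rule bounded_clinear_bounded_linear)
    have "bounded_clinear (\<lambda>x. s *\<^sub>R B x)" using B(1) by (rule bounded_clinear_scaleR)
    moreover have "s *\<^sub>R B (A x - t *\<^sub>R x) = x" for x using B(2)[of x] by (simp add: B.scaleR)
    moreover have "A (s *\<^sub>R B x) - t *\<^sub>R (s *\<^sub>R B x) = x" for x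
      using B(3)[of x] by (simp add: A.scaleR scaleR_diff_right mult.commute)
    ultimately show ?thesis
      by (auto simp: spectrum_def scaleC_of_real intro!: exI[of _ "\<lambda>x. s *\<^sub>R B x"])
  qed
  have "t \<notin> real_spectrum A" if "t < a" for t
    by (rule inv[of 1 "a - t"]) (use a that in \<open>auto simp: inner_simps power2_norm_eq_inner algebra_simps\<close>)
  moreover have "t \<notin> real_spectrum A" if "t > b" for t
    by (rule inv[of "-1" "t - b"]) (use b that in \<open>auto simp: inner_simps power2_norm_eq_inner algebra_simps\<close>)
  ultimately show ?thesis by (auto simp: not_less[symmetric])
qed

section \<open>Norms of polynomials in a self-adjoint operator\<close>

text \<open>Insert \<open>x - T x / K\<close> into the quadratic form of \<open>T\<close>.\<close>

lemma norm_sq_le_quadratic_form: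
  fixes T :: "'a::real_inner \<Rightarrow> 'a"
  assumes T: "linear T" "\<And>x y. inner (T x) y = inner x (T y)" "\<And>x. 0 \<le> inner (T x) x"
    and K: "K > 0" "\<And>x. norm (T x) \<le> norm x * K"
  shows "(norm (T x))\<^sup>2 \<le> K * inner (T x) x"
proof -
  have "inner (T (T x)) (T x) \<le> norm (T (T x)) * norm (T x)" by (rule norm_cauchy_schwarz)
  also have "\<dots> \<le> (norm (T x) * K) * norm (T x)" by (intro mult_right_mono K) auto
  finally have 1: "inner (T (T x)) (T x) \<le> K * (norm (T x))\<^sup>2"
    by (simp add: power2_eq_square mult_ac)
  define s where "s = inverse K"
  have s: "s > 0" "s * K = 1" using K by (simp_all add: s_def)
  have "inner (T (T x)) x = inner (T x) (T x)" by (rule T(2))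
  then have "inner (T (x - s *\<^sub>R T x)) (x - s *\<^sub>R T x)
      = inner (T x) x - 2 * s * (norm (T x))\<^sup>2 + s * s * inner (T (T x)) (T x)"
    by (simp add: linear_diff[OF T(1)] linear_scale[OF T(1)] inner_simps power2_norm_eq_inner algebra_simps)
  moreover have "s * s * inner (T (T x)) (T x) \<le> s * (norm (T x))\<^sup>2"
  proof -
    have "s * s * inner (T (T x)) (T x) \<le> s * s * (K * (norm (T x))\<^sup>2)"
      by (rule mult_left_mono[OF 1]) (use s in simp)
    also have "\<dots> = s * (s * K) * (norm (T x))\<^sup>2" by (simp only: mult.assoc)
    finally show ?thesis by (simp only: s mult_1_right)
  qed
  ultimately have "s * (norm (T x))\<^sup>2 \<le> inner (T x) x"
    using T(3)[of "x - s *\<^sub>R T x"] by simp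
  then have "K * (s * (norm (T x))\<^sup>2) \<le> K * inner (T x) x" using K(1) by (simp only: mult_le_cancel_left_pos)
  moreover have "K * (s * (norm (T x))\<^sup>2) = (norm (T x))\<^sup>2"
    using s(2) by (simp only: mult.assoc[symmetric] mult.commute[of K] mult_1_left)
  ultimately show ?thesis by simp
qed

text \<open>Let \<open>m\<close> be the infimum of the quadratic form of \<open>p(A)\<close> on the unit sphere. Then \<open>p(A) - m\<close>
  is not bounded below, so some root of \<open>p - m\<close> lies in the spectrum of \<open>A\<close>.\<close>

lemma spectral_value_le_quadratic_form:
  fixes A :: "'a::chilbert_space \<Rightarrow> 'a"
  assumes A: "selfadjoint A" and p: "degree p > 0" and x: "norm x = 1"
  obtains c where "c \<in> real_spectrum A" "poly p c \<le> inner (poly_op p A x) x"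
proof -
  note lin = selfadjoint_linear[OF A]
  let ?S = "poly_op p A"
  have S: "selfadjoint ?S" using A by (rule selfadjoint_poly_op)
  interpret S: bounded_linear ?S
    using S by (intro bounded_clinear_bounded_linear selfadjoint_bounded_clinear)
  obtain K where K: "K > 0" "\<And>x. norm (?S x) \<le> norm x * K"
    using S.pos_bounded by blast
  define D where "D = (\<lambda>x. inner (?S x) x) ` {x. norm x = 1}"
  have "- K \<le> inner (?S y) y" if "norm y = 1" for y
    using Cauchy_Schwarz_ineq2[of "?S y" y] K(2)[of y] that by simp
  then have bdd: "bdd_below D" unfolding D_def by (intro bdd_belowI[of _ "-K"]) auto
  define m where "m = Inf D"
  have m1: "m \<le> inner (?S y) y" if "norm y = 1" for y
    unfolding m_def using bdd that by (intro cInf_lower) (auto simp: D_def)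
  have m: "m * (norm y)\<^sup>2 \<le> inner (?S y) y" for y
  proof (cases "y = 0")
    case False
    let ?z = "inverse (norm y) *\<^sub>R y"
    have "norm y *\<^sub>R ?z = y" using False by simp
    moreover have "inner (?S (s *\<^sub>R z)) (s *\<^sub>R z) = s\<^sup>2 * inner (?S z) z" for s z
      by (simp add: S.scaleR power2_eq_square)
    ultimately have "inner (?S y) y = (norm y)\<^sup>2 * inner (?S ?z) ?z" by metis
    moreover have "m \<le> inner (?S ?z) ?z" using m1[of ?z] False by simp
    ultimately show ?thesis
      by (simp only: mult.commute[of m]) (rule mult_left_mono, simp_all)
  qed simp
  define q where "q = p - [:m:]"
  have q: "poly_op q A y = ?S y - m *\<^sub>R y" for y
    by (simp add: q_def poly_op_diff poly_op_pCons[OF lin] poly_op_0 linear_0[OF lin])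
  have "q \<noteq> 0" using p by (auto simp: q_def)
  have "\<not> bounded_below (poly_op q A)"
  proof
    assume "bounded_below (poly_op q A)"
    then obtain \<delta> where \<delta>: "\<delta> > 0" "\<And>y. \<delta> * norm y \<le> norm (poly_op q A y)"
      unfolding bounded_below_def by blast
    have T: "selfadjoint (poly_op q A)" using A by (rule selfadjoint_poly_op)
    interpret T: bounded_linear "poly_op q A"
      using T by (intro bounded_clinear_bounded_linear selfadjoint_bounded_clinear)
    obtain L where L: "L > 0" "\<And>x. norm (poly_op q A x) \<le> norm x * L"
      using T.pos_bounded by blast
    \<comment> \<open>A lower bound for \<open>S - m\<close> improves the infimum \<open>m\<close> of the quadratic form of \<open>S\<close>.\<close>
    have "m + \<delta>\<^sup>2 / L \<le> inner (?S y) y" if y: "norm y = 1" for y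
    proof -
      have "\<delta>\<^sup>2 \<le> (norm (poly_op q A y))\<^sup>2"
        using \<delta>(2)[of y] \<delta>(1) y by (intro power_mono) auto
      also have "\<dots> \<le> L * inner (poly_op q A y) y"
        using T m by (intro norm_sq_le_quadratic_form T.linear L)
          (auto simp: selfadjoint_def q inner_simps power2_norm_eq_inner)
      finally have "\<delta>\<^sup>2 / L \<le> inner (poly_op q A y) y" using L by (simp add: field_simps)
      then show ?thesis using y by (simp add: q inner_simps flip: power2_norm_eq_inner)
    qed
    moreover have "D \<noteq> {}" using x by (auto simp: D_def)
    ultimately have "m + \<delta>\<^sup>2 / L \<le> m" unfolding m_def
      by (intro cInf_greatest) (auto simp: D_def)
    moreover have "0 < \<delta>\<^sup>2 / L" using \<delta>(1) L(1) by simp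
    ultimately show False by linarith
  qed
  then obtain c where c: "poly q c = 0" "\<not> bounded_below (\<lambda>x. A x - c *\<^sub>R x)"
    using bounded_below_poly_op[OF A \<open>q \<noteq> 0\<close>] by blast
  show thesis
  proof (rule that)
    show "c \<in> real_spectrum A" using c(2) bounded_below_of_not_in_spectrum by blast
    show "poly p c \<le> inner (?S x) x" using c(1) m1[OF x] by (simp add: q_def)
  qed
qed

text \<open>For each value that the quadratic form takes at a unit vector, a nonconstant \<open>p\<close> has a value on the
  spectrum that is at most as large. A constant \<open>p\<close> needs the spectrum to be nonempty, which is the same statement for the identity
  polynomial.\<close>

lemma poly_op_nonneg:
  fixes A :: "'a::chilbert_space \<Rightarrow> 'a"
  assumes A: "selfadjoint A" and p: "\<And>t. t \<in> real_spectrum A \<Longrightarrow> 0 \<le> poly p t"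
  shows "0 \<le> inner (poly_op p A x) x"
proof (cases "x = 0")
  case False
  note lin = selfadjoint_linear[OF A]
  let ?z = "inverse (norm x) *\<^sub>R x"
  have z: "norm ?z = 1" using False by simp
  have "0 \<le> inner (poly_op p A ?z) ?z"
  proof (cases "degree p = 0")
    case True
    then obtain a where a: "p = [:a:]" by (rule degree_eq_zeroE)
    obtain c where "c \<in> real_spectrum A"
      using spectral_value_le_quadratic_form[OF A _ z, of "[:0, 1:]"] by auto
    then have "a \<ge> 0" using p a by auto
    then show ?thesis
      by (simp add: a poly_op_pCons[OF lin] poly_op_0 linear_0[OF lin])
  next
    case False
    then show ?thesis
      using spectral_value_le_quadratic_form[OF A _ z, of p] p by (metis gr0I order_trans)
  qed
  moreover interpret S: bounded_linear "poly_op p A"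
    using A by (intro bounded_clinear_bounded_linear bounded_clinear_poly_op selfadjoint_bounded_clinear)
  have "inner (poly_op p A ?z) ?z = (inverse (norm x))\<^sup>2 * inner (poly_op p A x) x"
    by (simp only: S.scaleR inner_scaleR_left inner_scaleR_right power2_eq_square mult.assoc)
  ultimately have "0 \<le> (inverse (norm x))\<^sup>2 * inner (poly_op p A x) x" by (simp only:)
  then show ?thesis using False by (simp add: zero_le_mult_iff)
qed simp

text \<open>Positivity of \<open>M\<^sup>2 - p(A)\<^sup>2\<close> means \<open>\<parallel>p(A) x\<parallel>\<^sup>2 \<le> M\<^sup>2 \<parallel>x\<parallel>\<^sup>2\<close>.\<close>

lemma norm_poly_op_le:
  fixes A :: "'a::chilbert_space \<Rightarrow> 'a"
  assumes A: "selfadjoint A" and p: "\<And>t. t \<in> real_spectrum A \<Longrightarrow> \<bar>poly p t\<bar> \<le> M" and M: "0 \<le> M"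
  shows "norm (poly_op p A x) \<le> M * norm x"
proof -
  note lin = selfadjoint_linear[OF A]
  have "0 \<le> poly ([:M\<^sup>2:] - p * p) t" if "t \<in> real_spectrum A" for t
    using power_mono[OF p[OF that], of 2] by (simp add: power2_eq_square)
  then have "0 \<le> inner (poly_op ([:M\<^sup>2:] - p * p) A x) x"
    by (rule poly_op_nonneg[OF A])
  moreover have "inner (poly_op p A (poly_op p A x)) x = (norm (poly_op p A x))\<^sup>2"
    using selfadjoint_poly_op[OF A, of p] by (simp add: selfadjoint_def power2_norm_eq_inner)
  ultimately have "(norm (poly_op p A x))\<^sup>2 \<le> (M * norm x)\<^sup>2"
    by (simp add: poly_op_diff poly_op_mult[OF lin] poly_op_pCons[OF lin] poly_op_0 linear_0[OF lin]
        inner_diff_left power_mult_distrib power2_norm_eq_inner[of x])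
  then show ?thesis by (rule power2_le_imp_le) (simp add: M)
qed

section \<open>Continuous functional calculus of positive operators\<close>

lemma polynomial_uniform_approximation:
  fixes h :: "real \<Rightarrow> real"
  assumes "compact S" "continuous_on S h"
  obtains p where "uniform_limit S (\<lambda>n. poly (p n)) h sequentially"
proof -
  have "\<exists>p. \<forall>t\<in>S. \<bar>h t - poly p t\<bar> < inverse (Suc n)" for n
  proof -
    obtain g where g: "real_polynomial_function g" "\<And>t. t \<in> S \<Longrightarrow> \<bar>h t - g t\<bar> < inverse (Suc n)"
      using Stone_Weierstrass_real_polynomial_function[OF assms, of "inverse (Suc n)"] by auto
    from g(1) obtain a k where "g = (\<lambda>t. \<Sum>i\<le>k. a i * t ^ i)"
      unfolding real_polynomial_function_iff_sum by blast
    then have "g t = poly (\<Sum>i\<le>k. monom (a i) i) t" for t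
      by (simp add: poly_sum poly_monom)
    then show ?thesis using g(2) by metis
  qed
  then obtain p where p: "\<And>n t. t \<in> S \<Longrightarrow> \<bar>h t - poly (p n) t\<bar> < inverse (Suc n)" by metis
  have "uniform_limit S (\<lambda>n. poly (p n)) h sequentially"
  proof (rule uniform_limitI)
    fix e :: real assume "e > 0"
    have "(\<lambda>n. inverse (real (Suc n))) \<longlonglongrightarrow> 0" by (rule LIMSEQ_inverse_real_of_nat)
    then have "\<forall>\<^sub>F n in sequentially. inverse (real (Suc n)) < e"
      using \<open>e > 0\<close> by (rule order_tendstoD)
    then show "\<forall>\<^sub>F n in sequentially. \<forall>t\<in>S. dist (poly (p n) t) (h t) < e"
    proof eventually_elim
      case (elim n)
      then show ?case using p[of _ n] by (force simp: dist_real_def abs_minus_commute)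
    qed
  qed
  then show thesis by (rule that)
qed

lemma positive_op_selfadjoint: "positive_op A \<Longrightarrow> selfadjoint A"
  by (simp add: positive_op_def)

lemma positive_op_bounded_clinear: "positive_op A \<Longrightarrow> bounded_clinear A"
  by (simp add: positive_op_def selfadjoint_def)

lemma positive_op_linear: "positive_op A \<Longrightarrow> linear A"
  by (simp add: positive_op_def selfadjoint_linear)

lemma real_spectrum_positive_op:
  fixes A :: "'a::chilbert_space \<Rightarrow> 'a"
  assumes "positive_op A"
  shows "real_spectrum A \<subseteq> {0..onorm A}"
proof (rule real_spectrum_subset)
  show A: "bounded_clinear A" using assms by (rule positive_op_bounded_clinear)
  show "0 * (norm x)\<^sup>2 \<le> inner (A x) x" for x using assms by (simp add: positive_op_def)
  show "inner (A x) x \<le> onorm A * (norm x)\<^sup>2" for x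
  proof -
    have "inner (A x) x \<le> norm (A x) * norm x" by (rule norm_cauchy_schwarz)
    also have "\<dots> \<le> (onorm A * norm x) * norm x"
      by (intro mult_right_mono onorm bounded_clinear_bounded_linear A) simp
    finally show ?thesis by (simp add: power2_eq_square mult.assoc)
  qed
qed

text \<open>Uniform convergence on the spectrum makes \<open>p n (A)\<close> a Cauchy sequence in operator norm, and
  the limit does not depend on the approximating polynomials.\<close>

lemma cfc_limit:
  fixes A :: "'a::chilbert_space \<Rightarrow> 'a"
  assumes A: "positive_op A" and h: "continuous_on {0..} h"
  shows bounded_clinear_cfc: "bounded_clinear (cfc h A)"
    and cfc_tendsto: "uniform_limit (real_spectrum A) (\<lambda>n. poly (p n)) h sequentially \<Longrightarrow>
      (\<lambda>n. poly_op (p n) A x) \<longlonglongrightarrow> cfc h A x"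
proof -
  let ?\<sigma> = "real_spectrum A"
  note sa = positive_op_selfadjoint[OF A]
  have bcl: "bounded_clinear (poly_op p A)" for p
    by (intro bounded_clinear_poly_op positive_op_bounded_clinear A)
  then have bl: "bounded_linear (poly_op p A)" for p by (rule bounded_clinear_bounded_linear)
  have near: "\<exists>N. \<forall>m\<ge>N. \<forall>n\<ge>N. \<forall>x. norm (poly_op (p m) A x - poly_op (q n) A x) \<le> e * norm x"
    if p: "uniform_limit ?\<sigma> (\<lambda>n. poly (p n)) h sequentially"
      and q: "uniform_limit ?\<sigma> (\<lambda>n. poly (q n)) h sequentially" and e: "e > 0" for p q e
  proof -
    have "\<forall>\<^sub>F n in sequentially. \<forall>t\<in>?\<sigma>. dist (poly (p n) t) (h t) < e / 2"
      "\<forall>\<^sub>F n in sequentially. \<forall>t\<in>?\<sigma>. dist (poly (q n) t) (h t) < e / 2"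
      using uniform_limitD[OF p, of "e / 2"] uniform_limitD[OF q, of "e / 2"] e by auto
    then obtain N1 N2 where N: "\<And>n t. n \<ge> N1 \<Longrightarrow> t \<in> ?\<sigma> \<Longrightarrow> dist (poly (p n) t) (h t) < e / 2"
        "\<And>n t. n \<ge> N2 \<Longrightarrow> t \<in> ?\<sigma> \<Longrightarrow> dist (poly (q n) t) (h t) < e / 2"
      unfolding eventually_sequentially by blast
    have "norm (poly_op (p m) A x - poly_op (q n) A x) \<le> e * norm x"
      if "m \<ge> max N1 N2" "n \<ge> max N1 N2" for m n x
      unfolding poly_op_diff[symmetric]
    proof (rule norm_poly_op_le[OF sa])
      fix t assume "t \<in> ?\<sigma>"
      then have "dist (poly (p m) t) (h t) < e / 2" "dist (poly (q n) t) (h t) < e / 2"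
        using N that by auto
      then show "\<bar>poly (p m - q n) t\<bar> \<le> e"
        unfolding dist_real_def poly_diff by linarith
    qed (use e in simp)
    then show ?thesis by blast
  qed
  have "compact {0..onorm A}" "continuous_on {0..onorm A} h"
    by (auto intro: continuous_on_subset[OF h])
  then obtain p0 where "uniform_limit {0..onorm A} (\<lambda>n. poly (p0 n)) h sequentially"
    by (rule polynomial_uniform_approximation)
  then have p0: "uniform_limit ?\<sigma> (\<lambda>n. poly (p0 n)) h sequentially"
    using real_spectrum_positive_op[OF A] by (rule uniform_limit_on_subset)
  define P where "P n = Blinfun (poly_op (p0 n) A)" for n
  have P: "blinfun_apply (P n) = poly_op (p0 n) A" for n
    by (simp add: P_def bounded_linear_Blinfun_apply bl)
  have "Cauchy P"
  proof (rule metric_CauchyI)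
    fix e :: real assume e: "e > 0"
    then obtain N where N: "\<And>m n x. m \<ge> N \<Longrightarrow> n \<ge> N \<Longrightarrow>
        norm (poly_op (p0 m) A x - poly_op (p0 n) A x) \<le> e / 2 * norm x"
      using near[OF p0 p0, of "e / 2"] by auto
    have "dist (P m) (P n) < e" if "m \<ge> N" "n \<ge> N" for m n
    proof -
      have "norm (P m - P n) \<le> e / 2"
        using N[OF that] e by (intro norm_blinfun_bound) (auto simp: blinfun.diff_left P)
      then show ?thesis using e by (simp add: dist_norm)
    qed
    then show "\<exists>N. \<forall>m\<ge>N. \<forall>n\<ge>N. dist (P m) (P n) < e" by blast
  qed
  then obtain L where L: "P \<longlonglongrightarrow> L" using Cauchy_convergent convergent_def by blast
  define B where "B = blinfun_apply L"
  have B: "(\<lambda>n. poly_op (p0 n) A x) \<longlonglongrightarrow> B x" for x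
    unfolding B_def P[symmetric] by (intro tendsto_intros L)
  have blB: "bounded_linear B" by (simp add: B_def blinfun.bounded_linear_right)
  have "B (c *\<^sub>C x) = c *\<^sub>C B x" for c x
  proof -
    have "(\<lambda>n. inner (poly_op (p0 n) A (c *\<^sub>C x) - c *\<^sub>C poly_op (p0 n) A x) y)
        \<longlonglongrightarrow> inner (B (c *\<^sub>C x) - c *\<^sub>C B x) y" for y
    proof -
      have "inner (c *\<^sub>C z) y = inner z (cnj c *\<^sub>C y)" for z
        by (simp add: inner_eq_Re_cinner cinner_scaleC_left cinner_scaleC_right)
      then show ?thesis unfolding inner_diff_left by (auto intro!: tendsto_intros B)
    qed
    moreover have "poly_op (p0 n) A (c *\<^sub>C x) - c *\<^sub>C poly_op (p0 n) A x = 0" for n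
      using bcl by (simp add: bounded_clinear_def)
    ultimately have "inner (B (c *\<^sub>C x) - c *\<^sub>C B x) y = 0" for y
      by (simp add: LIMSEQ_const_iff)
    then show ?thesis by (metis inner_eq_zero_iff eq_iff_diff_eq_0)
  qed
  with blB have bclB: "bounded_clinear B" by (simp add: bounded_clinear_def)
  have onormB: "(\<lambda>n. onorm (\<lambda>x. poly_op (q n) A x - B x)) \<longlonglongrightarrow> 0"
    if q: "uniform_limit ?\<sigma> (\<lambda>n. poly (q n)) h sequentially" for q
  proof (rule LIMSEQ_I)
    fix e :: real assume e: "e > 0"
    then obtain N where N: "\<And>m n x. m \<ge> N \<Longrightarrow> n \<ge> N \<Longrightarrow>
        norm (poly_op (q m) A x - poly_op (p0 n) A x) \<le> e / 2 * norm x"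
      using near[OF q p0, of "e / 2"] by auto
    have "norm (poly_op (q m) A x - B x) \<le> e / 2 * norm x" if "m \<ge> N" for m x
    proof (rule LIMSEQ_le_const2)
      show "(\<lambda>n. norm (poly_op (q m) A x - poly_op (p0 n) A x)) \<longlonglongrightarrow> norm (poly_op (q m) A x - B x)"
        by (intro tendsto_intros B)
    qed (use N that in blast)
    then have "onorm (\<lambda>x. poly_op (q m) A x - B x) \<le> e / 2" if "m \<ge> N" for m
      using that e by (intro onorm_bound) auto
    moreover have "0 \<le> onorm (\<lambda>x. poly_op (q m) A x - B x)" for m
      by (intro onorm_pos_le bounded_linear_sub bl blB)
    ultimately show "\<exists>N. \<forall>n\<ge>N. norm (onorm (\<lambda>x. poly_op (q n) A x - B x) - 0) < e"
      using e by (intro exI[of _ N]) force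
  qed
  have pointwise: "(\<lambda>n. poly_op (q n) A x) \<longlonglongrightarrow> C x"
    if C: "bounded_clinear C" and q: "(\<lambda>n. onorm (\<lambda>x. poly_op (q n) A x - C x)) \<longlonglongrightarrow> 0" for q C x
  proof -
    have "(\<lambda>n. onorm (\<lambda>x. poly_op (q n) A x - C x) * norm x) \<longlonglongrightarrow> 0 * norm x"
      by (intro tendsto_intros q)
    then have lim0: "(\<lambda>n. onorm (\<lambda>x. poly_op (q n) A x - C x) * norm x) \<longlonglongrightarrow> 0" by (simp only: mult_zero_left)
    have bd: "\<forall>n. norm (poly_op (q n) A x - C x) \<le> onorm (\<lambda>x. poly_op (q n) A x - C x) * norm x"
      by (intro allI onorm bounded_linear_sub bl bounded_clinear_bounded_linear C)
    have "(\<lambda>n. poly_op (q n) A x - C x) \<longlonglongrightarrow> 0"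
      by (rule Lim_null_comparison[OF always_eventually[OF bd] lim0])
    then show ?thesis by (rule LIM_zero_cancel)
  qed
  have eq: "cfc h A = B"
    unfolding cfc_def
  proof (rule the_equality)
    show "bounded_clinear B \<and> (\<exists>p. uniform_limit ?\<sigma> (\<lambda>n. poly (p n)) h sequentially \<and>
        (\<lambda>n. onorm (\<lambda>x. poly_op (p n) A x - B x)) \<longlonglongrightarrow> 0)"
      using bclB p0 onormB by blast
  next
    fix C assume "bounded_clinear C \<and> (\<exists>p. uniform_limit ?\<sigma> (\<lambda>n. poly (p n)) h sequentially \<and>
        (\<lambda>n. onorm (\<lambda>x. poly_op (p n) A x - C x)) \<longlonglongrightarrow> 0)"
    then obtain q where C: "bounded_clinear C" "uniform_limit ?\<sigma> (\<lambda>n. poly (q n)) h sequentially"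
        "(\<lambda>n. onorm (\<lambda>x. poly_op (q n) A x - C x)) \<longlonglongrightarrow> 0" by blast
    have "C x = B x" for x
      by (rule LIMSEQ_unique[OF pointwise[OF C(1,3)] pointwise[OF bclB onormB[OF C(2)]]])
    then show "C = B" ..
  qed
  show "bounded_clinear (cfc h A)" using bclB by (simp add: eq)
  show "(\<lambda>n. poly_op (p n) A x) \<longlonglongrightarrow> cfc h A x"
    if "uniform_limit ?\<sigma> (\<lambda>n. poly (p n)) h sequentially" for p x
    unfolding eq using pointwise[OF bclB onormB[OF that]] .
qed

lemma cfc_approximation:
  fixes A :: "'a::chilbert_space \<Rightarrow> 'a"
  assumes A: "positive_op A" and h: "continuous_on {0..} h"
  obtains p where "uniform_limit (real_spectrum A) (\<lambda>n. poly (p n)) h sequentially"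
    "\<And>x. (\<lambda>n. poly_op (p n) A x) \<longlonglongrightarrow> cfc h A x"
proof -
  have "compact {0..onorm A}" "continuous_on {0..onorm A} h"
    by (auto intro: continuous_on_subset[OF h])
  then obtain p where "uniform_limit {0..onorm A} (\<lambda>n. poly (p n)) h sequentially"
    by (rule polynomial_uniform_approximation)
  then have "uniform_limit (real_spectrum A) (\<lambda>n. poly (p n)) h sequentially"
    using real_spectrum_positive_op[OF A] by (rule uniform_limit_on_subset)
  then show thesis using that cfc_tendsto[OF A h] by blast
qed

lemma cfc_cong:
  fixes A :: "'a::chilbert_space \<Rightarrow> 'a"
  assumes "positive_op A" "\<And>t. 0 \<le> t \<Longrightarrow> h t = k t"
  shows "cfc h A = cfc k A"
proof -
  have "uniform_limit (real_spectrum A) p h F \<longleftrightarrow> uniform_limit (real_spectrum A) p k F"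
    for p :: "nat \<Rightarrow> real \<Rightarrow> real" and F
    by (rule uniform_limit_cong') (use real_spectrum_positive_op[OF assms(1)] assms(2) in auto)
  then show ?thesis unfolding cfc_def by simp
qed

lemma cfc_poly:
  fixes A :: "'a::chilbert_space \<Rightarrow> 'a"
  assumes "positive_op A"
  shows "cfc (poly p) A x = poly_op p A x"
proof -
  have "(\<lambda>n::nat. poly_op p A x) \<longlonglongrightarrow> cfc (poly p) A x"
    by (rule cfc_tendsto[OF assms continuous_on_poly[OF continuous_on_id] uniform_limit_const])
  then show ?thesis by (simp add: LIMSEQ_const_iff)
qed

lemma cfc_ident:
  fixes A :: "'a::chilbert_space \<Rightarrow> 'a"
  assumes "positive_op A"
  shows "cfc (\<lambda>t. t) A x = A x"
proof -
  have "(\<lambda>t. t) = poly [:0, 1::real:]" by (simp add: fun_eq_iff)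
  then show ?thesis
    using positive_op_linear[OF assms] by (simp add: cfc_poly[OF assms] poly_op_pCons poly_op_0 linear_0)
qed

lemma cfc_const:
  fixes A :: "'a::chilbert_space \<Rightarrow> 'a"
  assumes "positive_op A"
  shows "cfc (\<lambda>t. c) A x = c *\<^sub>R x"
proof -
  have "(\<lambda>t. c) = poly [:c:]" by (simp add: fun_eq_iff)
  then show ?thesis
    using positive_op_linear[OF assms] by (simp add: cfc_poly[OF assms] poly_op_pCons poly_op_0 linear_0)
qed

context
  fixes A :: "'a::chilbert_space \<Rightarrow> 'a" and h :: "real \<Rightarrow> real"
  assumes A: "positive_op A" and h: "continuous_on {0..} h"
begin

lemma cfc_add:
  assumes k: "continuous_on {0..} k"
  shows "cfc (\<lambda>t. h t + k t) A x = cfc h A x + cfc k A x"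
proof -
  obtain p where p: "uniform_limit (real_spectrum A) (\<lambda>n. poly (p n)) h sequentially"
    "\<And>x. (\<lambda>n. poly_op (p n) A x) \<longlonglongrightarrow> cfc h A x"
    using cfc_approximation[OF A h] by blast
  obtain q where q: "uniform_limit (real_spectrum A) (\<lambda>n. poly (q n)) k sequentially"
    "\<And>x. (\<lambda>n. poly_op (q n) A x) \<longlonglongrightarrow> cfc k A x"
    using cfc_approximation[OF A k] by blast
  have "uniform_limit (real_spectrum A) (\<lambda>n. poly (p n + q n)) (\<lambda>t. h t + k t) sequentially"
  proof -
    have "(\<lambda>n. poly (p n + q n)) = (\<lambda>n t. poly (p n) t + poly (q n) t)"
      by (simp add: fun_eq_iff)
    then show ?thesis using uniform_limit_add[OF p(1) q(1)] by (simp only:)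
  qed
  then have "(\<lambda>n. poly_op (p n + q n) A x) \<longlonglongrightarrow> cfc (\<lambda>t. h t + k t) A x"
    by (intro cfc_tendsto[OF A] continuous_intros h k)
  moreover have "(\<lambda>n. poly_op (p n + q n) A x) \<longlonglongrightarrow> cfc h A x + cfc k A x"
    unfolding poly_op_add by (intro tendsto_intros p q)
  ultimately show ?thesis by (rule LIMSEQ_unique)
qed

lemma selfadjoint_cfc: "selfadjoint (cfc h A)"
proof -
  obtain p where p: "\<And>x. (\<lambda>n. poly_op (p n) A x) \<longlonglongrightarrow> cfc h A x"
    using cfc_approximation[OF A h] by blast
  have "inner (cfc h A x) y = inner x (cfc h A y)" for x y
  proof (rule LIMSEQ_unique)
    show "(\<lambda>n. inner (poly_op (p n) A x) y) \<longlonglongrightarrow> inner (cfc h A x) y"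
      by (intro tendsto_intros p)
    have "inner (poly_op (p n) A x) y = inner x (poly_op (p n) A y)" for n
      using selfadjoint_poly_op[OF positive_op_selfadjoint[OF A]] by (simp add: selfadjoint_def)
    then show "(\<lambda>n. inner (poly_op (p n) A x) y) \<longlonglongrightarrow> inner x (cfc h A y)"
      by (auto intro!: tendsto_intros p)
  qed
  then show ?thesis using bounded_clinear_cfc[OF A h] by (simp add: selfadjoint_def)
qed

lemma inner_cfc: "inner (cfc h A x) y = inner x (cfc h A y)"
  using selfadjoint_cfc by (simp add: selfadjoint_def)

text \<open>The approximating polynomials may be slightly negative on the spectrum, but eventually
  \<open>p n + e\<close> is not.\<close>

lemma positive_op_cfc:
  assumes nonneg: "\<And>t. 0 \<le> t \<Longrightarrow> 0 \<le> h t"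
  shows "positive_op (cfc h A)"
proof -
  obtain p where p: "uniform_limit (real_spectrum A) (\<lambda>n. poly (p n)) h sequentially"
    "\<And>x. (\<lambda>n. poly_op (p n) A x) \<longlonglongrightarrow> cfc h A x"
    using cfc_approximation[OF A h] by blast
  have lower: "- e * (norm x)\<^sup>2 \<le> inner (cfc h A x) x" if e: "e > 0" for e x
  proof (rule tendsto_lowerbound)
    show "(\<lambda>n. inner (poly_op (p n) A x) x) \<longlonglongrightarrow> inner (cfc h A x) x"
      by (intro tendsto_intros p)
    show "\<forall>\<^sub>F n in sequentially. - e * (norm x)\<^sup>2 \<le> inner (poly_op (p n) A x) x"
      using uniform_limitD[OF p(1) e]
    proof eventually_elim
      case (elim n)
      have "0 \<le> poly (p n + [:e:]) t" if "t \<in> real_spectrum A" for t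
      proof -
        have "t \<in> {0..onorm A}" using that real_spectrum_positive_op[OF A] by blast
        then have "0 \<le> h t" "dist (poly (p n) t) (h t) < e" using elim nonneg that by auto
        then show ?thesis by (simp add: dist_real_def)
      qed
      then have "0 \<le> inner (poly_op (p n + [:e:]) A x) x"
        by (rule poly_op_nonneg[OF positive_op_selfadjoint[OF A]])
      then show ?case
        using positive_op_linear[OF A]
        by (simp add: poly_op_add poly_op_pCons poly_op_0 linear_0 inner_simps power2_norm_eq_inner)
    qed
  qed simp
  have "0 \<le> inner (cfc h A x) x" for x
  proof (cases "x = 0")
    case True
    then show ?thesis by simp
  next
    case False
    have "- inner (cfc h A x) x \<le> 0 + e" if "e > 0" for e
      using lower[of "e / (norm x)\<^sup>2" x] that False by simp
    then show ?thesis using field_le_epsilon[of "- inner (cfc h A x) x" 0] by simp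
  qed
  then show ?thesis using selfadjoint_cfc by (simp add: positive_op_def)
qed

text \<open>Passing to the limit weakly, with \<open>p n (A)\<close> moved to the other argument of the inner product, makes
  a uniform bound on these operators unnecessary.\<close>

lemma cfc_mult:
  assumes k: "continuous_on {0..} k"
  shows "cfc (\<lambda>t. h t * k t) A x = cfc h A (cfc k A x)"
proof -
  obtain p where p: "uniform_limit (real_spectrum A) (\<lambda>n. poly (p n)) h sequentially"
    "\<And>x. (\<lambda>n. poly_op (p n) A x) \<longlonglongrightarrow> cfc h A x"
    using cfc_approximation[OF A h] by blast
  obtain q where q: "uniform_limit (real_spectrum A) (\<lambda>n. poly (q n)) k sequentially"
    "\<And>x. (\<lambda>n. poly_op (q n) A x) \<longlonglongrightarrow> cfc k A x"
    using cfc_approximation[OF A k] by blast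
  have "bounded (F ` real_spectrum A)" if "continuous_on {0..} F" for F :: "real \<Rightarrow> real"
  proof -
    have "continuous_on {0..onorm A} F" by (rule continuous_on_subset[OF that]) auto
    then have "bounded (F ` {0..onorm A})"
      by (intro compact_imp_bounded compact_continuous_image) auto
    then show ?thesis by (rule bounded_subset) (use real_spectrum_positive_op[OF A] in blast)
  qed
  note bdd = this[OF h] this[OF k]
  have "uniform_limit (real_spectrum A) (\<lambda>n. poly (p n * q n)) (\<lambda>t. h t * k t) sequentially"
  proof -
    have "(\<lambda>n. poly (p n * q n)) = (\<lambda>n t. poly (p n) t * poly (q n) t)"
      by (simp add: fun_eq_iff)
    then show ?thesis using uniform_lim_mult[OF p(1) q(1) bdd] by (simp only:)
  qed
  then have lim: "(\<lambda>n. poly_op (p n * q n) A x) \<longlonglongrightarrow> cfc (\<lambda>t. h t * k t) A x"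
    by (intro cfc_tendsto[OF A] continuous_intros h k)
  have "inner (cfc (\<lambda>t. h t * k t) A x) y = inner (cfc h A (cfc k A x)) y" for y
  proof (rule LIMSEQ_unique)
    show "(\<lambda>n. inner (poly_op (p n * q n) A x) y) \<longlonglongrightarrow> inner (cfc (\<lambda>t. h t * k t) A x) y"
      by (intro tendsto_intros lim)
    have "inner (poly_op (p n * q n) A x) y = inner (poly_op (q n) A x) (poly_op (p n) A y)" for n
      using selfadjoint_poly_op[OF positive_op_selfadjoint[OF A], of "p n"]
      by (simp add: poly_op_mult[OF positive_op_linear[OF A]] selfadjoint_def)
    then show "(\<lambda>n. inner (poly_op (p n * q n) A x) y) \<longlonglongrightarrow> inner (cfc h A (cfc k A x)) y"
      unfolding inner_cfc by (auto intro!: tendsto_intros p q)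
  qed
  then have "inner (cfc (\<lambda>t. h t * k t) A x - cfc h A (cfc k A x)) y = 0" for y
    by (simp add: inner_diff_left)
  then show ?thesis by (metis inner_eq_zero_iff eq_iff_diff_eq_0)
qed

lemma norm_cfc_sq: "(norm (cfc h A x))\<^sup>2 = inner (cfc (\<lambda>t. (h t)\<^sup>2) A x) x"
  using cfc_mult[OF h, of x] by (simp add: power2_eq_square[of "h _"] power2_norm_eq_inner inner_cfc)

end

lemma inner_cfc_nonneg:
  fixes A :: "'a::chilbert_space \<Rightarrow> 'a"
  assumes "positive_op A" "continuous_on {0..} h" "\<And>t. 0 \<le> t \<Longrightarrow> 0 \<le> h t"
  shows "0 \<le> inner (cfc h A x) x"
  using positive_op_cfc[OF assms] by (simp add: positive_op_def)

lemma inner_cfc_mono: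
  fixes A :: "'a::chilbert_space \<Rightarrow> 'a"
  assumes A: "positive_op A" and h: "continuous_on {0..} h" and k: "continuous_on {0..} k"
    and le: "\<And>t. 0 \<le> t \<Longrightarrow> h t \<le> k t"
  shows "inner (cfc h A x) x \<le> inner (cfc k A x) x"
proof -
  have c: "continuous_on {0..} (\<lambda>t. k t - h t)" by (intro continuous_intros h k)
  have "0 \<le> inner (cfc (\<lambda>t. k t - h t) A x) x"
    by (rule inner_cfc_nonneg[OF A c]) (simp add: le)
  moreover have "cfc k A x = cfc (\<lambda>t. k t - h t) A x + cfc h A x"
    using cfc_add[OF A c h, of x] by simp
  ultimately show ?thesis by (simp add: inner_add_left)
qed

lemma norm_cfc_le:
  fixes A :: "'a::chilbert_space \<Rightarrow> 'a"
  assumes A: "positive_op A" and h: "continuous_on {0..} h"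
    and M: "\<And>t. 0 \<le> t \<Longrightarrow> \<bar>h t\<bar> \<le> M"
  shows "norm (cfc h A x) \<le> M * norm x"
proof -
  have "0 \<le> M" using M[of 0] by simp
  have "(norm (cfc h A x))\<^sup>2 \<le> inner (cfc (\<lambda>t. M\<^sup>2) A x) x"
    unfolding norm_cfc_sq[OF A h]
    using power_mono[OF M, of _ 2] by (intro inner_cfc_mono A continuous_intros h) auto
  also have "\<dots> = (M * norm x)\<^sup>2"
    by (simp add: cfc_const[OF A] power_mult_distrib power2_norm_eq_inner)
  finally show ?thesis by (rule power2_le_imp_le) (simp add: \<open>0 \<le> M\<close>)
qed

lemma cfc_intertwine:
  fixes A :: "'a::chilbert_space \<Rightarrow> 'a" and B :: "'b::chilbert_space \<Rightarrow> 'b"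
  assumes A: "positive_op A" and B: "positive_op B" and X: "bounded_linear X"
    and XA: "\<And>x. X (A x) = B (X x)" and h: "continuous_on {0..} h"
  shows "X (cfc h A x) = cfc h B (X x)"
proof -
  \<comment> \<open>The same polynomials must serve \<open>A\<close> and \<open>B\<close>.\<close>
  define K where "K = max (onorm A) (onorm B)"
  have "compact {0..K}" "continuous_on {0..K} h"
    by (auto intro: continuous_on_subset[OF h])
  then obtain p where unif: "uniform_limit {0..K} (\<lambda>n. poly (p n)) h sequentially"
    by (rule polynomial_uniform_approximation)
  have "real_spectrum A \<subseteq> {0..K}" "real_spectrum B \<subseteq> {0..K}"
    using real_spectrum_positive_op[OF A] real_spectrum_positive_op[OF B] by (force simp: K_def)+
  then have p: "(\<lambda>n. poly_op (p n) A x) \<longlonglongrightarrow> cfc h A x" "(\<lambda>n. poly_op (p n) B z) \<longlonglongrightarrow> cfc h B z"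
    for x z
    by (auto intro!: cfc_tendsto[OF A h] cfc_tendsto[OF B h] uniform_limit_on_subset[OF unif])
  interpret X: bounded_linear X by fact
  have "X (poly_op (p n) A x) = poly_op (p n) B (X x)" for n
    using A B XA by (intro poly_op_intertwine positive_op_linear X.linear)
  then have "(\<lambda>n. X (poly_op (p n) A x)) \<longlonglongrightarrow> cfc h B (X x)" using p(2) by simp
  moreover have "(\<lambda>n. X (poly_op (p n) A x)) \<longlonglongrightarrow> X (cfc h A x)"
    by (intro X.tendsto p)
  ultimately show ?thesis by (rule LIMSEQ_unique[symmetric])
qed

section \<open>The absolute value and the mixed Schwarz inequality\<close>

lemma positive_op_cadjoint_comp:
  assumes X: "bounded_clinear X"
  shows "positive_op (cadjoint X \<circ> X)"
proof -
  have "bounded_clinear (cadjoint X \<circ> X)"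
    using bounded_clinear_compose[OF bounded_clinear_cadjoint[OF X] X] by (simp add: o_def)
  then show ?thesis
    by (simp add: positive_op_def selfadjoint_def inner_cadjoint_left[OF X] inner_cadjoint[OF X, symmetric])
qed

lemma positive_op_abs:
  assumes X: "bounded_clinear X"
  shows "positive_op (op_abs X)"
  unfolding op_abs_def
  by (rule positive_op_cfc[OF positive_op_cadjoint_comp[OF X]])
    (auto intro: continuous_on_real_sqrt continuous_on_id)

context
  fixes X :: "'a::chilbert_space \<Rightarrow> 'b::chilbert_space"
  assumes X: "bounded_clinear X"
begin

lemma op_abs_square: "op_abs X (op_abs X x) = cadjoint X (X x)"
proof -
  note P = positive_op_cadjoint_comp[OF X]
  have c: "continuous_on {0..} sqrt"
    by (intro continuous_on_real_sqrt continuous_on_id)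
  have "op_abs X (op_abs X x) = cfc (\<lambda>t. sqrt t * sqrt t) (cadjoint X \<circ> X) x"
    unfolding op_abs_def by (rule cfc_mult[OF P c c, symmetric])
  also have "\<dots> = cfc (\<lambda>t. t) (cadjoint X \<circ> X) x"
    by (subst cfc_cong[OF P, of _ "\<lambda>t. t"]) auto
  also have "\<dots> = cadjoint X (X x)" by (simp add: cfc_ident[OF P])
  finally show ?thesis .
qed

lemma norm_op_abs: "norm (op_abs X x) = norm (X x)"
proof -
  have "(norm (op_abs X x))\<^sup>2 = inner (op_abs X (op_abs X x)) x"
    using positive_op_abs[OF X] by (simp add: power2_norm_eq_inner positive_op_def selfadjoint_def)
  also have "\<dots> = (norm (X x))\<^sup>2"
    by (simp add: op_abs_square inner_cadjoint_left[OF X] inner_cadjoint[OF X, symmetric]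
        power2_norm_eq_inner)
  finally show ?thesis by (simp add: power2_eq_iff_nonneg)
qed

text \<open>\<open>X\<close> intertwines \<open>X\<^sup>* X\<close> with \<open>X X\<^sup>*\<close>, hence also their square roots and functions of those.\<close>

lemma cfc_op_abs_intertwine:
  assumes h: "continuous_on {0..} h"
  shows "X (cfc h (op_abs X) x) = cfc h (op_abs (cadjoint X)) (X x)"
proof -
  note X' = bounded_clinear_cadjoint[OF X]
  note P = positive_op_cadjoint_comp[OF X] and Q = positive_op_cadjoint_comp[OF X']
  have "X (op_abs X y) = op_abs (cadjoint X) (X y)" for y
    unfolding op_abs_def
    by (rule cfc_intertwine[OF P Q bounded_clinear_bounded_linear[OF X]])
      (auto simp: cadjoint_cadjoint[OF X] intro: continuous_on_real_sqrt continuous_on_id)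
  then show ?thesis
    by (intro cfc_intertwine[OF positive_op_abs[OF X] positive_op_abs[OF X']
          bounded_clinear_bounded_linear[OF X]] h)
qed

text \<open>\<open>X (|X| + \<epsilon>)\<^sup>-\<^sup>1\<close> is a contraction that replaces the partial isometry of the polar
  decomposition: \<open>X\<close> differs from \<open>X (|X| + \<epsilon>)\<^sup>-\<^sup>1 |X|\<close> by at most \<open>\<epsilon>\<close>, and \<open>|X|\<close> factors as
  \<open>g(|X|) f(|X|)\<close>, of which \<open>g(|X|)\<close> moves through \<open>X\<close> to the other side.\<close>

lemma mixed_schwarz_inner:
  assumes f: "continuous_on {0..} f" and g: "continuous_on {0..} g"
    and fg: "\<And>t. t \<ge> 0 \<Longrightarrow> f t * g t = t"
  shows "inner (X x) y \<le> norm (cfc f (op_abs X) x) * norm (cfc g (op_abs (cadjoint X)) y)"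
proof -
  define A where "A = op_abs X"
  define B where "B = op_abs (cadjoint X)"
  have A: "positive_op A" unfolding A_def by (rule positive_op_abs[OF X])
  have B: "positive_op B"
    unfolding B_def by (rule positive_op_abs[OF bounded_clinear_cadjoint[OF X]])
  have nX: "norm (X z) = norm (A z)" for z unfolding A_def by (rule norm_op_abs[symmetric])
  interpret X: bounded_linear X using X by (rule bounded_clinear_bounded_linear)
  let ?R = "norm (cfc f A x) * norm (cfc g B y)"
  have main: "inner (X x) y \<le> ?R + \<epsilon> * (norm x * norm y)" if eps: "\<epsilon> > 0" for \<epsilon>
  proof -
    define k where "k t = inverse (t + \<epsilon>)" for t :: real
    have k: "continuous_on {0..} k"
      unfolding k_def using eps by (intro continuous_intros) auto
    have kt: "continuous_on {0..} (\<lambda>t. t * k t)" by (intro continuous_intros k)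
    let ?u = "cfc k A (A x)"
    have u: "?u = cfc (\<lambda>t. t * k t) A x"
    proof -
      have "cfc (\<lambda>t. k t * t) A x = cfc k A (cfc (\<lambda>t. t) A x)"
        by (rule cfc_mult[OF A k]) (rule continuous_on_id)
      then show ?thesis by (simp add: cfc_ident[OF A] mult.commute)
    qed
    \<comment> \<open>\<open>X\<close> and \<open>|X|\<close> have the same norm on every vector, so both estimates can be made for functions
      of \<open>|X|\<close>: here \<open>t / (t + \<epsilon>) \<le> 1\<close>, and below \<open>\<epsilon> t / (t + \<epsilon>) \<le> \<epsilon>\<close>.\<close>
    have contr: "norm (X (cfc k A z)) \<le> norm z" for z
    proof -
      have "A (cfc k A z) = cfc (\<lambda>t. t * k t) A z"
        using cfc_mult[OF A continuous_on_id k, of z] by (simp add: cfc_ident[OF A])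
      moreover have "norm (cfc (\<lambda>t. t * k t) A z) \<le> 1 * norm z"
        by (rule norm_cfc_le[OF A kt]) (use eps in \<open>simp add: k_def field_simps\<close>)
      ultimately show ?thesis by (simp add: nX)
    qed
    have err: "norm (X x - X ?u) \<le> \<epsilon> * norm x"
    proof -
      let ?h = "\<lambda>t. t * (1 + (-1) * (t * k t))"
      have c: "continuous_on {0..} (\<lambda>t. 1 + (-1) * (t * k t))" by (intro continuous_intros kt)
      have "cfc (\<lambda>t. (-1) * (t * k t)) A x = - ?u"
        using cfc_mult[OF A continuous_on_const kt, of "-1" x] by (simp add: cfc_const[OF A] u)
      then have "cfc (\<lambda>t. 1 + (-1) * (t * k t)) A x = x - ?u"
        using cfc_add[OF A continuous_on_const, of "\<lambda>t. (-1) * (t * k t)" 1 x]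
        by (simp add: cfc_const[OF A] continuous_intros kt)
      then have "A (x - ?u) = cfc ?h A x"
        using cfc_mult[OF A continuous_on_id c, of x] by (simp add: cfc_ident[OF A])
      moreover have "norm (cfc ?h A x) \<le> \<epsilon> * norm x"
      proof (rule norm_cfc_le[OF A])
        show "continuous_on {0..} ?h" by (intro continuous_intros kt)
        show "\<bar>?h t\<bar> \<le> \<epsilon>" if t: "0 \<le> t" for t
        proof -
          have "?h t = \<epsilon> * (t * k t)" using eps t by (simp add: k_def field_simps)
          moreover have "0 \<le> t * k t" "t * k t \<le> 1" using eps t by (simp_all add: k_def field_simps)
          ultimately have "0 \<le> ?h t" "?h t \<le> \<epsilon>" using eps by (simp_all only: mult_left_le zero_le_mult_iff) auto
          then show ?thesis by (simp only: abs_of_nonneg)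
        qed
      qed
      ultimately show ?thesis by (simp add: nX flip: X.diff)
    qed
    have "inner (X ?u) y \<le> ?R"
    proof -
      have "A x = cfc (\<lambda>t. g t * f t) A x"
        using cfc_cong[OF A, of "\<lambda>t. g t * f t" "\<lambda>t. t"] fg
        by (simp add: mult.commute[of "g _"] cfc_ident[OF A])
      then have "A x = cfc g A (cfc f A x)" by (simp add: cfc_mult[OF A g f])
      then have "?u = cfc (\<lambda>t. k t * g t) A (cfc f A x)" by (simp add: cfc_mult[OF A k g])
      also have "\<dots> = cfc g A (cfc k A (cfc f A x))"
        by (simp add: mult.commute[of "k _"] cfc_mult[OF A g k])
      finally have "X ?u = cfc g B (X (cfc k A (cfc f A x)))"
        using cfc_op_abs_intertwine[OF g] by (simp add: A_def B_def)
      then have "inner (X ?u) y = inner (X (cfc k A (cfc f A x))) (cfc g B y)"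
        by (simp add: inner_cfc[OF B g])
      also have "\<dots> \<le> norm (X (cfc k A (cfc f A x))) * norm (cfc g B y)"
        by (rule norm_cauchy_schwarz)
      also have "\<dots> \<le> ?R" by (intro mult_right_mono contr) simp
      finally show ?thesis .
    qed
    moreover have "inner (X x - X ?u) y \<le> \<epsilon> * norm x * norm y"
      by (rule order_trans[OF norm_cauchy_schwarz mult_right_mono[OF err]]) simp
    ultimately show ?thesis by (simp add: inner_diff_left mult.assoc)
  qed
  have "inner (X x) y \<le> ?R + e" if e: "e > 0" for e
  proof -
    define \<epsilon> where "\<epsilon> = e / (norm x * norm y + 1)"
    have "norm x * norm y + 1 > 0" by (simp add: add_nonneg_pos)
    then have "\<epsilon> > 0" "\<epsilon> * (norm x * norm y) \<le> e"
      using e by (simp_all add: \<epsilon>_def field_simps)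
    then show ?thesis using main[of \<epsilon>] by linarith
  qed
  then show ?thesis unfolding A_def B_def by (rule field_le_epsilon)
qed

lemma mixed_schwarz:
  assumes f: "continuous_on {0..} f" and g: "continuous_on {0..} g"
    and fg: "\<And>t. t \<ge> 0 \<Longrightarrow> f t * g t = t"
  shows "cmod (cinner (X x) y) \<le> norm (cfc f (op_abs X) x) * norm (cfc g (op_abs (cadjoint X)) y)"
proof -
  obtain c where c: "cmod c = 1" "cmod (cinner (X x) y) = inner (c *\<^sub>C X x) y"
    by (rule cmod_cinner_obtain_unimodular)
  have "bounded_clinear (cfc f (op_abs X))" by (rule bounded_clinear_cfc[OF positive_op_abs[OF X] f])
  then have "norm (cfc f (op_abs X) (c *\<^sub>C x)) = norm (cfc f (op_abs X) x)"
    using c(1) by (simp add: bounded_clinear_def norm_scaleC)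
  moreover have "c *\<^sub>C X x = X (c *\<^sub>C x)" using X by (simp add: bounded_clinear_def)
  ultimately show ?thesis using mixed_schwarz_inner[OF f g fg, of "c *\<^sub>C x" y] c(2) by simp
qed

end

section \<open>Power inequalities\<close>

lemma continuous_on_powr_const:
  fixes f :: "real \<Rightarrow> real"
  assumes "continuous_on S f" "\<And>t. t \<in> S \<Longrightarrow> 0 \<le> f t" "a > 0"
  shows "continuous_on S (\<lambda>t. f t powr a)"
  by (rule continuous_on_powr'[OF assms(1) continuous_on_const]) (use assms(2,3) in auto)

lemma powr_ge_tangent:
  fixes s c r :: real
  assumes r: "r \<ge> 1" and "s \<ge> 0" and c: "c > 0"
  shows "c powr r + r * c powr (r - 1) * (s - c) \<le> s powr r"
proof (cases "s = 0")
  case True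
  have "c powr (r - 1) * c = c powr r" using c by (simp add: powr_diff)
  then have "r * c powr (r - 1) * (s - c) = - r * c powr r" using True by simp
  moreover have "1 * c powr r \<le> r * c powr r" using r by (intro mult_right_mono) auto
  ultimately have "c powr r + r * c powr (r - 1) * (s - c) \<le> 0" by linarith
  then show ?thesis by (rule order_trans) simp
next
  case False
  have "r * c powr (r - 1) * (s - c) \<le> s powr r - c powr r"
  proof (rule convex_on_imp_above_tangent[OF powr_convex[OF r]])
    show "((\<lambda>x. x powr r) has_real_derivative r * c powr (r - 1)) (at c within {0<..})"
      by (rule has_field_derivative_at_within[OF has_real_derivative_powr[OF c]])
  qed (use c False assms in \<open>auto simp: interior_open\<close>)
  then show ?thesis by linarith
qed

text \<open>Add the tangent line inequalities at the midpoint of \<open>a\<close> and \<open>b\<close>; their linear terms cancel.\<close>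

lemma powr_add_le:
  fixes a b r :: real
  assumes r: "r \<ge> 1" and ab: "a \<ge> 0" "b \<ge> 0"
  shows "(a + b) powr r \<le> 2 powr (r - 1) * (a powr r + b powr r)"
proof (cases "a + b = 0")
  case False
  define c where "c = (a + b) / 2"
  have c: "c > 0" using False ab by (simp add: c_def)
  have "a - c + (b - c) = 0" by (simp add: c_def)
  then have "r * c powr (r - 1) * (a - c) + r * c powr (r - 1) * (b - c) = 0"
    by (simp flip: distrib_left)
  then have "2 * c powr r \<le> a powr r + b powr r"
    using powr_ge_tangent[OF r ab(1) c] powr_ge_tangent[OF r ab(2) c] by linarith
  then have "2 powr (r - 1) * (2 * c powr r) \<le> 2 powr (r - 1) * (a powr r + b powr r)"
    by (rule mult_left_mono) simp
  moreover have "2 powr (r - 1) * (2 * c powr r) = (a + b) powr r"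
    using c by (simp add: c_def powr_divide powr_diff)
  ultimately show ?thesis by simp
qed (use ab in auto)

text \<open>McCarthy's inequality for \<open>f(A)\<^sup>2\<close>: the tangent line inequality at
  \<open>c = \<langle>f(A)\<^sup>2 x, x\<rangle>\<close> holds pointwise for \<open>f\<^sup>2\<close> and passes to quadratic forms by monotonicity of the
  functional calculus. The constant term of the tangent is at most 0, which is why \<open>\<parallel>x\<parallel> \<le> 1\<close>
  suffices.\<close>

lemma mccarthy:
  fixes A :: "'a::chilbert_space \<Rightarrow> 'a"
  assumes A: "positive_op A" and f: "continuous_on {0..} f" and nonneg: "\<And>t. 0 \<le> t \<Longrightarrow> 0 \<le> f t"
    and r: "r \<ge> 1" and x: "norm x \<le> 1"
  shows "norm (cfc f A x) powr (2 * r) \<le> inner (cfc (\<lambda>t. f t powr (2 * r)) A x) x"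
proof -
  let ?h = "\<lambda>t. f t powr (2 * r)"
  have h: "continuous_on {0..} ?h"
    by (rule continuous_on_powr_const[OF f]) (use r nonneg in auto)
  define c where "c = (norm (cfc f A x))\<^sup>2"
  have cr: "norm (cfc f A x) powr (2 * r) = c powr r"
    by (simp add: c_def powr_powr flip: powr_numeral)
  show ?thesis
  proof (cases "c = 0")
    case True
    then show ?thesis unfolding cr by (simp add: inner_cfc_nonneg[OF A h])
  next
    case False
    then have c: "c > 0" by (simp add: c_def)
    define \<beta> where "\<beta> = r * c powr (r - 1)"
    define \<alpha> where "\<alpha> = c powr r - \<beta> * c"
    have "inner (cfc (\<lambda>t. \<alpha> + \<beta> * (f t)\<^sup>2) A x) x \<le> inner (cfc ?h A x) x"
    proof (rule inner_cfc_mono[OF A _ h])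
      show "continuous_on {0..} (\<lambda>t. \<alpha> + \<beta> * (f t)\<^sup>2)" by (intro continuous_intros f)
      fix t :: real assume "0 \<le> t"
      then have "0 \<le> f t" by (rule nonneg)
      then have "((f t)\<^sup>2) powr r = f t powr (2 * r)"
        by (cases "f t = 0") (simp_all add: powr_powr flip: powr_numeral)
      then show "\<alpha> + \<beta> * (f t)\<^sup>2 \<le> f t powr (2 * r)"
        using powr_ge_tangent[OF r _ c, of "(f t)\<^sup>2"] by (simp add: \<alpha>_def \<beta>_def algebra_simps)
    qed
    also have "cfc (\<lambda>t. \<alpha> + \<beta> * (f t)\<^sup>2) A x = \<alpha> *\<^sub>R x + \<beta> *\<^sub>R cfc (\<lambda>t. (f t)\<^sup>2) A x"
      by (simp add: cfc_add[OF A] cfc_mult[OF A] cfc_const[OF A] continuous_intros f)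
    also have "inner \<dots> x = \<alpha> * (norm x)\<^sup>2 + \<beta> * c"
      by (simp add: inner_simps c_def norm_cfc_sq[OF A f] power2_norm_eq_inner[of x])
    finally have *: "\<alpha> * (norm x)\<^sup>2 + \<beta> * c \<le> inner (cfc ?h A x) x" .
    have "c powr (r - 1) * c = c powr r" using c by (simp add: powr_diff)
    then have "\<alpha> = (1 - r) * c powr r" by (simp add: \<alpha>_def \<beta>_def algebra_simps)
    then have "\<alpha> \<le> 0" using r by (simp add: mult_nonpos_nonneg)
    moreover have "(norm x)\<^sup>2 \<le> 1" using x by (simp add: power_le_one)
    ultimately have "\<alpha> * 1 \<le> \<alpha> * (norm x)\<^sup>2" by (intro mult_left_mono_neg)
    then show ?thesis using * by (simp add: cr \<alpha>_def)
  qed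
qed

lemma cauchy_schwarz_sqrt:
  assumes "a \<ge> 0" "b \<ge> 0" "c \<ge> 0" "d \<ge> (0::real)"
  shows "sqrt a * sqrt b + sqrt c * sqrt d \<le> sqrt (a + c) * sqrt (b + d)"
proof (rule power2_le_imp_le)
  have "(sqrt a * sqrt b + sqrt c * sqrt d)\<^sup>2 = a * b + c * d + 2 * (sqrt a * sqrt d) * (sqrt c * sqrt b)"
    using assms by (simp add: power2_sum power_mult_distrib)
  also have "2 * (sqrt a * sqrt d) * (sqrt c * sqrt b) \<le> a * d + c * b"
    using sum_squares_bound[of "sqrt a * sqrt d" "sqrt c * sqrt b"] assms
    by (simp add: power_mult_distrib)
  finally show "(sqrt a * sqrt b + sqrt c * sqrt d)\<^sup>2 \<le> (sqrt (a + c) * sqrt (b + d))\<^sup>2"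
    using assms by (simp add: power_mult_distrib algebra_simps)
qed (use assms in simp)

text \<open>The mixed Schwarz inequality raised to the power \<open>r\<close>, with McCarthy's inequality applied to
  both factors.\<close>

lemma mixed_schwarz_powr:
  fixes X :: "'a::chilbert_space \<Rightarrow> 'b::chilbert_space"
  assumes X: "bounded_clinear X"
    and f: "continuous_on {0..} f" and g: "continuous_on {0..} g"
    and nonneg: "\<And>t. t \<ge> 0 \<Longrightarrow> 0 \<le> f t" "\<And>t. t \<ge> 0 \<Longrightarrow> 0 \<le> g t"
    and fg: "\<And>t. t \<ge> 0 \<Longrightarrow> f t * g t = t" and r: "r \<ge> 1"
    and xy: "norm x \<le> 1" "norm y \<le> 1"
  shows "cmod (cinner (X x) y) powr r
    \<le> sqrt (inner (cfc (\<lambda>t. f t powr (2 * r)) (op_abs X) x) x)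
      * sqrt (inner (cfc (\<lambda>t. g t powr (2 * r)) (op_abs (cadjoint X)) y) y)"
proof -
  let ?u = "norm (cfc f (op_abs X) x)" and ?v = "norm (cfc g (op_abs (cadjoint X)) y)"
  have sq: "a powr r = sqrt (a powr (2 * r))" if "a \<ge> 0" for a
    using that by (simp add: powr_half_sqrt[symmetric] powr_powr)
  have "continuous_on {0..} (\<lambda>t. f t powr (2 * r))"
    by (rule continuous_on_powr_const[OF f]) (use r nonneg in auto)
  then have pos: "0 \<le> inner (cfc (\<lambda>t. f t powr (2 * r)) (op_abs X) x) x"
    by (rule inner_cfc_nonneg[OF positive_op_abs[OF X]]) simp
  have "cmod (cinner (X x) y) powr r \<le> (?u * ?v) powr r"
    using r by (intro powr_mono2 mixed_schwarz[OF X f g fg]) auto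
  also have "\<dots> = sqrt (?u powr (2 * r)) * sqrt (?v powr (2 * r))"
    by (simp add: powr_mult flip: sq)
  also have "\<dots> \<le> sqrt (inner (cfc (\<lambda>t. f t powr (2 * r)) (op_abs X) x) x)
      * sqrt (inner (cfc (\<lambda>t. g t powr (2 * r)) (op_abs (cadjoint X)) y) y)"
    by (intro mult_mono real_sqrt_le_mono mccarthy positive_op_abs bounded_clinear_cadjoint
        X f g r xy nonneg) (auto simp: pos)
  finally show ?thesis .
qed

section \<open>The numerical radius inequality\<close>

lemma inner_le_onorm:
  fixes A :: "'a::real_inner \<Rightarrow> 'a"
  assumes "bounded_linear A" "norm x \<le> 1"
  shows "inner (A x) x \<le> onorm A"
proof -
  have "inner (A x) x \<le> norm (A x) * norm x" by (rule norm_cauchy_schwarz)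
  also have "\<dots> \<le> (onorm A * norm x) * norm x"
    by (intro mult_right_mono onorm assms) simp
  also have "\<dots> \<le> onorm A * 1 * 1"
    using assms(2) onorm_pos_le[OF assms(1)] by (intro mult_mono) auto
  finally show ?thesis by simp
qed

theorem theorem2p14:
  fixes X :: "'b::chilbert_space \<Rightarrow> 'a::chilbert_space"
    and Y :: "'a \<Rightarrow> 'b"
    and f g :: "real \<Rightarrow> real"
    and r :: real
  assumes nontrivial: "(UNIV :: ('a \<times> 'b) set) \<noteq> {0}"
    and X: "bounded_clinear X"
    and Y: "bounded_clinear Y"
    and f_cont: "continuous_on {0..} f"
    and g_cont: "continuous_on {0..} g"
    and f_nonneg: "\<And>t. t \<ge> 0 \<Longrightarrow> f t \<ge> 0"
    and g_nonneg: "\<And>t. t \<ge> 0 \<Longrightarrow> g t \<ge> 0"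
    and fg: "\<And>t. t \<ge> 0 \<Longrightarrow> f t * g t = t"
    and r: "r \<ge> 1"
  shows "let T = (\<lambda>(x1, x2). (X x2, Y x1)) :: 'a \<times> 'b \<Rightarrow> 'a \<times> 'b;
             P = (\<lambda>x. cfc (\<lambda>t. f t powr (2 * r)) (op_abs X) x
                    + cfc (\<lambda>t. g t powr (2 * r)) (op_abs (cadjoint Y)) x);
             Q = (\<lambda>x. cfc (\<lambda>t. f t powr (2 * r)) (op_abs Y) x
                    + cfc (\<lambda>t. g t powr (2 * r)) (op_abs (cadjoint X)) x);
             \<zeta> = (\<lambda>(x1, x2). (sqrt (Re (cinner (P x2) x2)) - sqrt (Re (cinner (Q x1) x1)))\<^sup>2)
         in numerical_radius T powr r
            \<le> 2 powr (r - 2) * (onorm P + onorm Q)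
              - 2 powr (r - 2) * (INF x\<in>{x :: 'a \<times> 'b. norm x = 1}. \<zeta> x)"
proof -
  define T :: "'a \<times> 'b \<Rightarrow> 'a \<times> 'b" where "T = (\<lambda>(x1, x2). (X x2, Y x1))"
  let ?F = "\<lambda>t. f t powr (2 * r)" and ?G = "\<lambda>t. g t powr (2 * r)"
  define P where "P = (\<lambda>x. cfc ?F (op_abs X) x + cfc ?G (op_abs (cadjoint Y)) x)"
  define Q where "Q = (\<lambda>x. cfc ?F (op_abs Y) x + cfc ?G (op_abs (cadjoint X)) x)"
  define \<zeta> :: "'a \<times> 'b \<Rightarrow> real" where
    "\<zeta> = (\<lambda>(x1, x2). (sqrt (Re (cinner (P x2) x2)) - sqrt (Re (cinner (Q x1) x1)))\<^sup>2)"
  define R where "R = 2 powr (r - 2) * (onorm P + onorm Q)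
    - 2 powr (r - 2) * (INF x\<in>{x :: 'a \<times> 'b. norm x = 1}. \<zeta> x)"
  have F: "continuous_on {0..} ?F" and G: "continuous_on {0..} ?G"
    by (rule continuous_on_powr_const[OF f_cont] continuous_on_powr_const[OF g_cont];
        use r f_nonneg g_nonneg in simp)+
  note X' = bounded_clinear_cadjoint[OF X] and Y' = bounded_clinear_cadjoint[OF Y]
  note pos = positive_op_abs[OF X] positive_op_abs[OF Y] positive_op_abs[OF X'] positive_op_abs[OF Y']
  have "bounded_clinear P" "bounded_clinear Q"
    unfolding P_def Q_def by (intro bounded_clinear_add bounded_clinear_cfc pos F G)+
  then have bl: "bounded_linear P" "bounded_linear Q"
    by (simp_all add: bounded_clinear_bounded_linear)
  have bound: "cmod (cinner (T x) x) powr r \<le> R" if x: "norm x = 1" for x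
  proof (cases x)
    case (Pair x1 x2)
    have "norm x1 \<le> 1" "norm x2 \<le> 1"
      using x norm_fst_le[of x1 x2] norm_snd_le[of x2 x1] by (simp_all add: Pair)
    note le1 = this
    define a where "a = inner (cfc ?F (op_abs X) x2) x2"
    define a' where "a' = inner (cfc ?G (op_abs (cadjoint Y)) x2) x2"
    define b where "b = inner (cfc ?F (op_abs Y) x1) x1"
    define b' where "b' = inner (cfc ?G (op_abs (cadjoint X)) x1) x1"
    have nonneg: "0 \<le> a" "0 \<le> a'" "0 \<le> b" "0 \<le> b'"
      unfolding a_def a'_def b_def b'_def
      by (intro inner_cfc_nonneg pos F G; simp)+
    define p where "p = a + a'"
    define q where "q = b + b'"
    have pq: "p = inner (P x2) x2" "q = inner (Q x1) x1"
      by (simp_all add: p_def q_def a_def a'_def b_def b'_def P_def Q_def inner_add_left)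
    have pq_nonneg: "0 \<le> p" "0 \<le> q" using nonneg by (simp_all add: p_def q_def)
    have "cmod (cinner (T x) x) = cmod (cinner (X x2) x1 + cinner (Y x1) x2)"
      by (simp add: Pair T_def cinner_prod_def)
    also have "\<dots> \<le> cmod (cinner (X x2) x1) + cmod (cinner (Y x1) x2)"
      by (rule norm_triangle_ineq)
    finally have "cmod (cinner (T x) x) powr r
        \<le> (cmod (cinner (X x2) x1) + cmod (cinner (Y x1) x2)) powr r"
      using r by (intro powr_mono2) auto
    also have "\<dots> \<le> 2 powr (r - 1) *
        (cmod (cinner (X x2) x1) powr r + cmod (cinner (Y x1) x2) powr r)"
      by (rule powr_add_le[OF r]) auto
    also have "\<dots> \<le> 2 powr (r - 1) * (sqrt a * sqrt b' + sqrt b * sqrt a')"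
      unfolding a_def a'_def b_def b'_def
      by (intro mult_left_mono add_mono mixed_schwarz_powr X Y f_cont g_cont f_nonneg g_nonneg fg r le1) auto
    also have "\<dots> \<le> 2 powr (r - 1) * (sqrt p * sqrt q)"
      using cauchy_schwarz_sqrt[OF nonneg(1,4,2,3)]
      by (intro mult_left_mono) (simp_all add: p_def q_def mult.commute add.commute)
    also have "\<dots> = 2 powr (r - 2) * (p + q - (sqrt p - sqrt q)\<^sup>2)"
    proof -
      have "p + q - (sqrt p - sqrt q)\<^sup>2 = 2 * (sqrt p * sqrt q)"
        using pq_nonneg by (simp add: power2_diff)
      moreover have "2 powr (r - 1) = 2 powr (r - 2) * 2" by (simp add: powr_diff)
      ultimately show ?thesis by simp
    qed
    also have "\<dots> \<le> 2 powr (r - 2) * (onorm P + onorm Q - (INF x\<in>{x. norm x = 1}. \<zeta> x))"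
    proof (intro mult_left_mono diff_mono add_mono)
      show "p \<le> onorm P" "q \<le> onorm Q"
        unfolding pq by (intro inner_le_onorm bl le1)+
      have "bdd_below (\<zeta> ` {x. norm x = 1})"
        by (rule bdd_belowI[of _ 0]) (auto simp: \<zeta>_def)
      then have "(INF x\<in>{x. norm x = 1}. \<zeta> x) \<le> \<zeta> x"
        by (rule cINF_lower) (simp add: x)
      then show "(INF x\<in>{x. norm x = 1}. \<zeta> x) \<le> (sqrt p - sqrt q)\<^sup>2"
        by (simp add: \<zeta>_def Pair pq inner_eq_Re_cinner)
    qed simp
    finally show ?thesis by (simp add: R_def right_diff_distrib)
  qed
  \<comment> \<open>A unit vector exists, so \<open>R\<close> is nonnegative and the supremum is over a nonempty set.\<close>
  obtain z :: "'a \<times> 'b" where "z \<noteq> 0" using nontrivial by blast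
  then have z: "norm ((1 / norm z) *\<^sub>R z) = 1" by simp
  have R: "0 \<le> R" using bound[OF z] by (rule order_trans[rotated]) simp
  have le: "cmod (cinner (T x) x) \<le> R powr (1 / r)" if "norm x = 1" for x
  proof -
    have "(cmod (cinner (T x) x) powr r) powr (1 / r) \<le> R powr (1 / r)"
      using r that by (intro powr_mono2 bound) auto
    then show ?thesis using r by (simp add: powr_powr)
  qed
  have "numerical_radius T \<le> R powr (1 / r)"
    unfolding numerical_radius_def by (rule cSUP_least) (use z le in blast)+
  moreover have "0 \<le> numerical_radius T"
    unfolding numerical_radius_def
  proof (rule cSUP_upper2[where x = "(1 / norm z) *\<^sub>R z"])
    show "bdd_above ((\<lambda>x. cmod (cinner (T x) x)) ` {x. norm x = 1})"
      by (rule bdd_aboveI2[of _ _ "R powr (1 / r)"]) (simp add: le)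
  qed (use z in \<open>simp_all only: mem_Collect_eq norm_ge_zero\<close>)
  ultimately have "numerical_radius T powr r \<le> (R powr (1 / r)) powr r"
    using r by (intro powr_mono2) auto
  also have "\<dots> = R" using r R by (simp add: powr_powr)
  finally show ?thesis
    by (simp only: Let_def R_def \<zeta>_def T_def P_def Q_def)
qed

end
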